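(* For every integer $n\ge 0$ and each $t\in\{17,35\}$, $$d(45n+t)\equiv 0\pmod 5.$$
   Context: For a positive integer $k$, $(q^k;q^k)_\infty:=\prod_{m\ge 1}(1-q^{km})$, viewed as a formal power series in $q$ with integer coefficients. The integers $d(n)$ ($n\ge 0$) are defined by the generating function $$\sum_{n=0}^\infty d(n)q^n=\frac{(q^3;q^3)_\infty^3}{(q;q)_\infty(q^2;q^2)_\infty}.$$ *)

theory Defs
  imports
    "HOL-Analysis.Infinite_Products"
    "HOL-Computational_Algebra.Formal_Power_Series"
    "HOL-Number_Theory.Cong"
begin

(* (q^k; q^k)_infinity for k > 0; the infinite product is the library's, taken in the
   X-adic topology of formal power series. The index is shifted so that m ranges over m >= 1. *)
definition euler_prod :: "nat \<Rightarrow> int fps" where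
  "euler_prod k = prodinf (\<lambda>m. 1 - fps_X ^ (k * Suc m))"

(* int is not an instance of the class inverse, so fps division is not available over int.
   fps_left_inverse f 1 is the multiplicative inverse of a series f with constant term 1. *)
definition d_gf :: "int fps" where
  "d_gf = euler_prod 3 ^ 3 * fps_left_inverse (euler_prod 1 * euler_prod 2) 1"

definition d :: "nat \<Rightarrow> int" where
  "d n = fps_nth d_gf n"

lemma has_prod_euler_prod:
  assumes "k > 0"
  shows "(\<lambda>m. 1 - fps_X ^ (k * Suc m)) has_prod euler_prod k"
    and "fps_nth (euler_prod k) 0 = 1"
proof -
  define P :: "nat \<Rightarrow> int fps" where "P = (\<lambda>N. \<Prod>m\<le>N. 1 - fps_X ^ (k * Suc m))"
  define G where "G = Abs_fps (\<lambda>n. fps_nth (P n) n)"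
  have Suc: "fps_nth (P (Suc N)) n = fps_nth (P N) n" if "n \<le> N" for n N
  proof -
    have "1 * Suc (Suc N) \<le> k * Suc (Suc N)"
      using assms by (intro mult_le_mono1) simp
    then have "n < k * Suc (Suc N)"
      using that by simp
    moreover have "P (Suc N) = P N - P N * fps_X ^ (k * Suc (Suc N))"
      by (simp add: P_def algebra_simps)
    ultimately show ?thesis
      by (simp add: fps_X_power_mult_right_nth)
  qed
  have nth: "fps_nth (P N) n = fps_nth G n" if "n \<le> N" for n N
    using that by (induction rule: dec_induct) (simp_all add: G_def Suc)
  have "P \<longlonglongrightarrow> G"
  proof (rule tendsto_fpsI)
    show "eventually (\<lambda>N. fps_nth (P N) n = fps_nth G n) sequentially" for n
      using eventually_ge_at_top[of n] by (rule eventually_mono) (rule nth)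
  qed
  moreover have G0: "fps_nth G 0 = 1"
    using assms by (simp add: G_def P_def)
  ultimately have "(\<lambda>m. 1 - fps_X ^ (k * Suc m)) has_prod G"
    by (auto simp: has_prod_def raw_has_prod_def P_def)
  moreover from this have "G = euler_prod k"
    unfolding euler_prod_def by (rule has_prod_unique)
  ultimately show "(\<lambda>m. 1 - fps_X ^ (k * Suc m)) has_prod euler_prod k"
    and "fps_nth (euler_prod k) 0 = 1"
    using G0 by simp_all
qed

lemma d_generating_function:
  "Abs_fps d * (euler_prod 1 * euler_prod 2) = euler_prod 3 ^ 3"
proof -
  have "fps_left_inverse (euler_prod 1 * euler_prod 2) 1 * (euler_prod 1 * euler_prod 2) = 1"
    by (rule fps_left_inverse) (simp add: has_prod_euler_prod)
  moreover have "Abs_fps d = d_gf"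
    by (simp add: d_def fps_eq_iff)
  ultimately show ?thesis
    by (simp add: d_gf_def mult.assoc)
qed

end

theory Submission
  imports Defs
begin

text \<open>
  Write \<open>E k\<close> for the infinite product \<open>(q^k; q^k)\<close>. The generating function \<open>D\<close> satisfies \<open>D * E 1 * E 2 = E 3 ^ 3\<close>, and
  the residues \<open>17\<close> and \<open>35\<close> modulo \<open>45\<close> are both \<open>8\<close> modulo \<open>9\<close>. So one extracts the exponents
  congruent to \<open>2\<close> modulo \<open>3\<close> twice, which gives the series \<open>D''\<close> of the numbers \<open>d(9n + 8)\<close>.

  The extraction is possible because \<open>E 1\<close> and \<open>E 2\<close> are controlled by two theta functions,
  \<open>psi = E 2 ^ 2 / E 1\<close> and \<open>phi = E 1 ^ 2 / E 2\<close>. As theta functions are sums over a quadratic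
  exponent, splitting the index modulo \<open>3\<close> dissects them at once. Jacobi's triple product turns the
  pieces back into products and shows that both dissections involve the same function:
  \<open>psi = a (1 + u)\<close> and \<open>phi = g (1 - 2 u)\<close>, where \<open>a\<close> and \<open>g\<close> are series in \<open>q^3\<close> and \<open>u\<close> is
  \<open>q\<close> times a series in \<open>q^3\<close> (lemma \<open>parametrization\<close>). To divide by \<open>1 + u\<close> or \<open>1 - 2 u\<close>, multiply by the
  conjugates \<open>1 - u + u^2\<close> and \<open>1 + 2 u + 4 u^2\<close>: the denominators become \<open>1 + u^3\<close> and
  \<open>1 - 8 u^3\<close>, which are series in \<open>q^3\<close>. They are known products, since up to a factor they are the
  products of \<open>psi\<close> and of \<open>phi\<close> over the substitutions of \<open>w q\<close> for \<open>q\<close> with \<open>w^3 = 1\<close>. These products are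
  handled without roots of unity, by the cubic norm form of the three components modulo \<open>3\<close>.

  The first extraction picks the term \<open>3 u^2\<close> of \<open>(1 - u + u^2) (1 + 2 u + 4 u^2)\<close> and gives
  \<open>D' * E 1 * E 2 ^ 4 = 3 * E 3 ^ 3 * E 6 ^ 3\<close> (lemma \<open>trisection_d\<close>). Since
  \<open>E 1 * E 2 ^ 4 = psi ^ 3 * phi ^ 2\<close>, the second one picks
  \<open>6 u^2 - 15 u^5 + 60 u^8\<close> from \<open>(1 - u + u^2)^3 (1 + 2 u + 4 u^2)^2\<close>. Modulo \<open>5\<close> only one term survives,
  so \<open>D''\<close> is congruent to a single product: \<open>D'' * E 1 ^ 5 * E 2 ^ 9\<close> is congruent to \<open>3 * E 3 ^ 15\<close>
  (lemma \<open>ninesection_d_mod_5\<close>).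

  Multiply by \<open>E 2\<close>. Fifth powers are series in \<open>q^5\<close> modulo \<open>5\<close>, so \<open>D''\<close> times a unit in \<open>q^5\<close> is
  congruent to \<open>E 2\<close> times a series in \<open>q^5\<close>. By the pentagonal number theorem the exponents of
  \<open>E 2\<close> are \<open>3 j^2 - j\<close>, which are \<open>0\<close>, \<open>2\<close> or \<open>4\<close> modulo \<open>5\<close>. Hence \<open>d(9m + 8)\<close> vanishes
  modulo \<open>5\<close> when \<open>m\<close> is \<open>1\<close> or \<open>3\<close> modulo \<open>5\<close>, and these are the two claimed progressions.
\<close>

section \<open>Dilation and dissection of power series\<close>

definition dilate :: "nat \<Rightarrow> 'a::idom fps \<Rightarrow> 'a fps" where
  "dilate k F = F oo fps_X ^ k"

text \<open>
  The coefficients of \<open>F\<close> at the exponents \<open>r\<close> modulo \<open>m\<close>, reindexed as a series of their own: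
  \<open>F\<close> is the sum of the \<open>X ^ r * dilate m (dissect m r F)\<close> over \<open>r < m\<close>.
\<close>
definition dissect :: "nat \<Rightarrow> nat \<Rightarrow> 'a fps \<Rightarrow> 'a fps" where
  "dissect m r F = Abs_fps (\<lambda>n. fps_nth F (m * n + r))"

lemma dissect_nth [simp]: "fps_nth (dissect m r F) n = fps_nth F (m * n + r)"
  by (simp add: dissect_def)

lemma dilate_nth:
  assumes "k > 0"
  shows "fps_nth (dilate k F) n = (if k dvd n then fps_nth F (n div k) else 0)"
proof -
  have *: "fps_nth ((fps_X ^ k) ^ i) n = (if n = k * i then 1 else (0::'a))" for i
    by (simp flip: power_mult)
  have "fps_nth (dilate k F) n = (\<Sum>i=0..n. if n = k * i then fps_nth F i else 0)"
    unfolding dilate_def fps_compose_nth * by (rule sum.cong) auto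
  also have "\<dots> = (if k dvd n then fps_nth F (n div k) else 0)"
  proof (cases "k dvd n")
    case True
    then obtain j where j: "n = k * j" by blast
    then have "j \<le> n" using assms by simp
    have "(\<Sum>i=0..n. if n = k * i then fps_nth F i else 0) = (\<Sum>i=0..n. if i = j then fps_nth F i else 0)"
      using assms j by (intro sum.cong) auto
    also have "\<dots> = fps_nth F j" using \<open>j \<le> n\<close> by simp
    finally show ?thesis using assms j by simp
  next
    case False
    then show ?thesis by (auto intro!: sum.neutral)
  qed
  finally show ?thesis .
qed

lemma dilate_mult: "k > 0 \<Longrightarrow> dilate k (F * G) = dilate k F * dilate k G"
  by (simp add: dilate_def fps_compose_mult_distrib)

lemma dilate_power: "k > 0 \<Longrightarrow> dilate k (F ^ n) = dilate k F ^ n"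
  by (simp add: dilate_def fps_compose_power)

lemma dilate_add: "dilate k (F + G) = dilate k F + dilate k G"
  by (simp add: dilate_def fps_compose_add_distrib)

lemma dilate_diff: "dilate k (F - G) = dilate k F - dilate k G"
  by (simp add: dilate_def fps_compose_sub_distrib)

lemma dilate_uminus: "dilate k (- F) = - dilate k F"
  by (simp add: dilate_def fps_compose_uminus)

lemma dilate_numeral [simp]: "dilate k (numeral c) = numeral c"
  by (simp add: dilate_def)

lemma dilate_0 [simp]: "dilate k 0 = 0"
  by (simp add: dilate_def)

lemma dilate_1 [simp]: "dilate k 1 = 1"
  by (simp add: dilate_def)

lemma dilate_X: "k > 0 \<Longrightarrow> dilate k fps_X = fps_X ^ k"
  by (simp add: dilate_def)

lemma dilate_dilate: "k > 0 \<Longrightarrow> l > 0 \<Longrightarrow> dilate k (dilate l F) = dilate (k * l) F"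
  by (rule fps_ext) (auto simp: dilate_nth div_mult2_eq dvd_div_iff_mult mult.commute
      dest: dvd_mult_left dvd_mult_right)

lemma dissect_add: "dissect m r (F + G) = dissect m r F + dissect m r G"
  by (rule fps_ext) simp

lemma dissect_diff: "dissect m r (F - G) = dissect m r F - dissect m r G"
  by (rule fps_ext) simp

text \<open>
  A factor that is a series in \<open>q^m\<close> does not move residue classes. This is what lets one
  read off one residue class of an identity whose denominators have been made series in \<open>q^m\<close>.
\<close>
lemma dissect_dilate_mult:
  assumes m: "m > 0" and r: "r < m"
  shows "dissect m r (dilate m U * F) = U * dissect m r F"
proof (rule fps_ext)
  fix n
  have "fps_nth (dissect m r (dilate m U * F)) n =
      (\<Sum>i=0..m*n+r. fps_nth (dilate m U) i * fps_nth F (m*n+r-i))"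
    by (simp add: fps_mult_nth)
  also have "\<dots> = (\<Sum>i\<in>(\<lambda>j. m*j) ` {0..n}. fps_nth (dilate m U) i * fps_nth F (m*n+r-i))"
  proof (rule sum.mono_neutral_right)
    show "\<forall>i\<in>{0..m*n+r} - (*) m ` {0..n}. fps_nth (dilate m U) i * fps_nth F (m*n+r-i) = 0"
    proof
      fix i assume i: "i \<in> {0..m*n+r} - (*) m ` {0..n}"
      have "\<not> m dvd i"
      proof
        assume "m dvd i"
        then obtain j where j: "i = m * j" by blast
        with i r have "m * j < m * Suc n" by simp
        then have "j \<le> n" by (simp only: mult_less_cancel1 less_Suc_eq_le)
        with i j show False by auto
      qed
      then show "fps_nth (dilate m U) i * fps_nth F (m*n+r-i) = 0"
        using m by (simp add: dilate_nth)
    qed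
  qed (simp_all add: image_subset_iff trans_le_add1)
  also have "\<dots> = (\<Sum>j=0..n. fps_nth (dilate m U) (m*j) * fps_nth F (m*n+r-m*j))"
    using m by (subst sum.reindex) (auto simp: inj_on_def)
  also have "\<dots> = (\<Sum>j=0..n. fps_nth U j * fps_nth F (m*(n-j)+r))"
    using m by (intro sum.cong) (auto simp: dilate_nth right_diff_distrib')
  finally show "fps_nth (dissect m r (dilate m U * F)) n = fps_nth (U * dissect m r F) n"
    by (simp add: fps_mult_nth)
qed

lemma dissect_X_power_mult_dilate:
  assumes "r < m"
  shows "dissect m r (fps_X ^ i * dilate m V) =
    (if i mod m = r then fps_X ^ (i div m) * V else 0)"
proof (rule fps_ext)
  fix n
  have m: "m > 0" using assms by simp
  have "m * n + r < i \<longleftrightarrow> n < i div m" if "i mod m = r"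
    using that m by (metis add_less_cancel_right mult_div_mod_eq nat_mult_less_cancel1)
  moreover have "m dvd m * n + r - i \<and> (m * n + r - i) div m = n - i div m"
    if "i mod m = r" "\<not> m * n + r < i"
  proof -
    have "m * n + r - i = m * (n - i div m)"
      using that(1) by (metis add_diff_cancel_right mult_div_mod_eq right_diff_distrib')
    then show ?thesis using m by simp
  qed
  moreover have "\<not> m dvd m * n + r - i" if "i mod m \<noteq> r" "\<not> m * n + r < i"
  proof
    assume "m dvd m * n + r - i"
    then obtain k where "m * n + r - i = m * k" by blast
    then have "m * n + r = i + m * k" using that(2) by simp
    then have "(m * n + r) mod m = (i + m * k) mod m" by simp
    then show False using that(1) assms by simp
  qed
  ultimately show "fps_nth (dissect m r (fps_X ^ i * dilate m V)) n =
      fps_nth (if i mod m = r then fps_X ^ (i div m) * V else 0) n"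
    using m by (auto simp: fps_X_power_mult_nth dilate_nth)
qed

lemma dissect_dilate: "r < m \<Longrightarrow> dissect m r (dilate m V) = (if r = 0 then V else 0)"
  using dissect_X_power_mult_dilate[of r m 0 V] by auto

lemma decompose_mod_3:
  "F = dilate 3 (dissect 3 0 F) + fps_X * dilate 3 (dissect 3 1 F) + fps_X ^ 2 * dilate 3 (dissect 3 2 F)"
proof (rule fps_ext)
  fix n
  obtain i r where n: "n = 3 * i + r" "r < (3::nat)"
    using mult_div_mod_eq[of 3 n] mod_less_divisor[of 3 n] by (metis zero_less_numeral)
  then consider "r = 0" | "r = 1" | "r = 2" by linarith
  then show "fps_nth F n = fps_nth (dilate 3 (dissect 3 0 F) + fps_X * dilate 3 (dissect 3 1 F) +
      fps_X ^ 2 * dilate 3 (dissect 3 2 F)) n"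
  proof cases
    case 1
    have "\<not> 3 dvd 3 * i - Suc 0" if "i > 0" using that by presburger
    moreover have "\<not> 3 dvd 3 * i - 2" if "i > 0" using that by presburger
    ultimately show ?thesis
      using 1 n by (cases "i = 0") (auto simp: fps_X_power_mult_nth dilate_nth)
  next
    case 2
    have "\<not> 3 dvd 3 * i + 1" "\<not> 3 dvd 3 * i - 1 \<or> i = 0" by presburger+
    then show ?thesis
      using 2 n by (auto simp: fps_X_power_mult_nth dilate_nth)
  next
    case 3
    have "\<not> 3 dvd 3 * i + 2" "\<not> 3 dvd 3 * i + 1" by presburger+
    then show ?thesis
      using 3 n by (auto simp: fps_X_power_mult_nth dilate_nth)
  qed
qed

section \<open>The cubic norm\<close>

text \<open>
  With \<open>a, b, c\<close> the three components of \<open>F\<close> modulo \<open>3\<close> and \<open>w\<close> a primitive cube root of unity,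
  this is the series \<open>N\<close> with \<open>N(q^3) = F(q) F(w q) F(w^2 q)\<close>. The explicit form is
  \<open>a^3 + b^3 + c^3 - 3 a b c\<close> applied to \<open>a(q^3), q b(q^3), q^2 c(q^3)\<close>, and it keeps the
  coefficients in the base ring.
\<close>
definition cubic_norm :: "'a::idom fps \<Rightarrow> 'a fps" where
  "cubic_norm F = dissect 3 0 F ^ 3 + fps_X * dissect 3 1 F ^ 3 + fps_X ^ 2 * dissect 3 2 F ^ 3
     - 3 * fps_X * dissect 3 0 F * dissect 3 1 F * dissect 3 2 F"

lemma dissect_decomposed:
  fixes a b c :: "'a::idom fps"
  shows "dissect 3 0 (dilate 3 a + fps_X * dilate 3 b + fps_X ^ 2 * dilate 3 c) = a"
    "dissect 3 (Suc 0) (dilate 3 a + fps_X * dilate 3 b + fps_X ^ 2 * dilate 3 c) = b"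
    "dissect 3 2 (dilate 3 a + fps_X * dilate 3 b + fps_X ^ 2 * dilate 3 c) = c"
  using dissect_X_power_mult_dilate[of 0 3 1 b] dissect_X_power_mult_dilate[of 1 3 1 b]
    dissect_X_power_mult_dilate[of 2 3 1 b]
  by (simp_all add: dissect_add dissect_X_power_mult_dilate dissect_dilate)

lemma cubic_norm_decomposed:
  "cubic_norm (dilate 3 a + fps_X * dilate 3 b + fps_X ^ 2 * dilate 3 c) =
     a ^ 3 + fps_X * b ^ 3 + fps_X ^ 2 * c ^ 3 - 3 * fps_X * a * b * c"
  by (simp add: cubic_norm_def dissect_decomposed)

text \<open>
  The cubic form is the norm of a free ring extension of rank three, so it is multiplicative;
  concretely this is a polynomial identity in the six components and \<open>q\<close>.
\<close>
lemma cubic_norm_mult: "cubic_norm (F * G) = cubic_norm F * cubic_norm G"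
proof -
  define a b c where "a = dissect 3 0 F" and "b = dissect 3 1 F" and "c = dissect 3 2 F"
  define a' b' c' where "a' = dissect 3 0 G" and "b' = dissect 3 1 G" and "c' = dissect 3 2 G"
  have F: "F = dilate 3 a + fps_X * dilate 3 b + fps_X ^ 2 * dilate 3 c"
    and G: "G = dilate 3 a' + fps_X * dilate 3 b' + fps_X ^ 2 * dilate 3 c'"
    unfolding a_def b_def c_def a'_def b'_def c'_def by (rule decompose_mod_3)+
  define A B C where "A = a * a' + fps_X * (b * c' + c * b')"
    and "B = a * b' + b * a' + fps_X * (c * c')" and "C = a * c' + b * b' + c * a'"
  have "F * G = dilate 3 A + fps_X * dilate 3 B + fps_X ^ 2 * dilate 3 C"
    unfolding F G A_def B_def C_def
    by (simp add: dilate_add dilate_mult dilate_X algebra_simps power2_eq_square power3_eq_cube)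
  then have "cubic_norm (F * G) = A ^ 3 + fps_X * B ^ 3 + fps_X ^ 2 * C ^ 3 - 3 * fps_X * A * B * C"
    by (simp only: cubic_norm_decomposed)
  also have "\<dots> = cubic_norm F * cubic_norm G"
    unfolding A_def B_def C_def F G cubic_norm_decomposed
    by algebra
  finally show ?thesis .
qed

section \<open>Limits of power series and Euler products\<close>

text \<open>
  A coefficient of a product involves finitely many coefficients of the factors, so the ring
  operations are continuous in the X-adic topology. This carries identities between finite partial
  products over to the infinite products.
\<close>
lemma tendsto_mult_fps:
  fixes F G :: "'a::comm_ring_1 fps"
  assumes "(f \<longlongrightarrow> F) A" "(g \<longlongrightarrow> G) A"
  shows "((\<lambda>x. f x * g x) \<longlongrightarrow> F * G) A"
proof (rule tendsto_fpsI)
  fix n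
  have "eventually (\<lambda>x. \<forall>i\<in>{0..n}. fps_nth (f x) i = fps_nth F i) A"
    and "eventually (\<lambda>x. \<forall>i\<in>{0..n}. fps_nth (g x) i = fps_nth G i) A"
    using assms by (simp_all add: tendsto_fps_iff eventually_ball_finite_distrib)
  then show "eventually (\<lambda>x. fps_nth (f x * g x) n = fps_nth (F * G) n) A"
    by eventually_elim (simp add: fps_mult_nth)
qed

lemma tendsto_power_fps:
  fixes F :: "'a::comm_ring_1 fps"
  assumes "(f \<longlongrightarrow> F) A"
  shows "((\<lambda>x. f x ^ k) \<longlongrightarrow> F ^ k) A"
  by (induction k) (auto intro!: tendsto_mult_fps assms)

lemma tendsto_add_fps:
  fixes F G :: "'a::comm_ring_1 fps"
  assumes "(f \<longlongrightarrow> F) A" "(g \<longlongrightarrow> G) A"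
  shows "((\<lambda>x. f x + g x) \<longlongrightarrow> F + G) A"
proof (rule tendsto_fpsI)
  show "eventually (\<lambda>x. fps_nth (f x + g x) n = fps_nth (F + G) n) A" for n
    using assms[unfolded tendsto_fps_iff, rule_format, of n] by eventually_elim simp
qed

lemma tendsto_diff_fps:
  fixes F G :: "'a::comm_ring_1 fps"
  assumes "(f \<longlongrightarrow> F) A" "(g \<longlongrightarrow> G) A"
  shows "((\<lambda>x. f x - g x) \<longlongrightarrow> F - G) A"
proof (rule tendsto_fpsI)
  show "eventually (\<lambda>x. fps_nth (f x - g x) n = fps_nth (F - G) n) A" for n
    using assms[unfolded tendsto_fps_iff, rule_format, of n] by eventually_elim simp
qed

lemma tendsto_dissect:
  fixes F :: "'a::comm_ring_1 fps"
  assumes "(f \<longlongrightarrow> F) A"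
  shows "((\<lambda>x. dissect m r (f x)) \<longlongrightarrow> dissect m r F) A"
proof (rule tendsto_fpsI)
  show "eventually (\<lambda>x. fps_nth (dissect m r (f x)) n = fps_nth (dissect m r F) n) A" for n
    using assms[unfolded tendsto_fps_iff, rule_format, of "m * n + r"] by eventually_elim simp
qed

lemma tendsto_dilate:
  assumes "k > 0" "(f \<longlongrightarrow> F) A"
  shows "((\<lambda>x. dilate k (f x)) \<longlongrightarrow> dilate k F) A"
proof (rule tendsto_fpsI)
  show "eventually (\<lambda>x. fps_nth (dilate k (f x)) n = fps_nth (dilate k F) n) A" for n
    using assms(2)[unfolded tendsto_fps_iff, rule_format, of "n div k"]
    by eventually_elim (simp add: dilate_nth assms(1))
qed

lemma tendsto_cubic_norm:
  assumes "(f \<longlongrightarrow> F) A"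
  shows "((\<lambda>x. cubic_norm (f x)) \<longlongrightarrow> cubic_norm F) A"
  unfolding cubic_norm_def
  by (intro tendsto_diff_fps tendsto_add_fps tendsto_mult_fps tendsto_power_fps tendsto_dissect
      tendsto_const assms)

definition euler_partial :: "nat \<Rightarrow> nat \<Rightarrow> int fps" where
  "euler_partial k N = (\<Prod>i<N. 1 - fps_X ^ (k * Suc i))"

lemma euler_partial_0 [simp]: "euler_partial k 0 = 1"
  by (simp add: euler_partial_def)

lemma euler_partial_Suc: "euler_partial k (Suc N) = euler_partial k N * (1 - fps_X ^ (k * Suc N))"
  by (simp add: euler_partial_def)

text \<open>
  Partial products of any length \<open>c * N\<close> may be used. The freedom in \<open>c\<close> lets several products
  advance together, each by its own number of factors, in one induction on \<open>N\<close>.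
\<close>
lemma tendsto_euler_partial:
  assumes "k > 0" "c > 0"
  shows "(\<lambda>N. euler_partial k (c * N)) \<longlonglongrightarrow> euler_prod k"
proof -
  have "euler_partial k \<longlonglongrightarrow> euler_prod k"
    using has_prod_imp_tendsto'[OF has_prod_euler_prod(1)[OF assms(1)]]
    by (simp add: euler_partial_def [abs_def])
  moreover have "strict_mono (\<lambda>N. c * N)"
    using assms(2) by (simp add: strict_mono_def)
  ultimately show ?thesis
    using LIMSEQ_subseq_LIMSEQ by (fastforce simp: o_def)
qed

lemma tendsto_euler_partial': "k > 0 \<Longrightarrow> euler_partial k \<longlonglongrightarrow> euler_prod k"
  using tendsto_euler_partial[of k 1] by simp

lemma dilate_euler_prod:
  assumes "k > 0" "l > 0"
  shows "dilate k (euler_prod l) = euler_prod (k * l)"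
proof (rule LIMSEQ_unique)
  show "(\<lambda>N. dilate k (euler_partial l N)) \<longlonglongrightarrow> dilate k (euler_prod l)"
    by (intro tendsto_dilate tendsto_euler_partial' assms)
  have "dilate k (euler_partial l N) = euler_partial (k * l) N" for N
    using assms(1)
    by (induction N) (simp_all add: euler_partial_Suc dilate_mult dilate_diff dilate_power dilate_X
        algebra_simps flip: power_mult)
  then show "(\<lambda>N. dilate k (euler_partial l N)) \<longlonglongrightarrow> euler_prod (k * l)"
    using tendsto_euler_partial'[of "k * l"] assms by simp
qed

text \<open>
  Over the cube roots of unity, \<open>1 - X ^ m\<close> has norm \<open>1 - q^(3 m)\<close> if \<open>3\<close> does not divide \<open>m\<close>, and
  otherwise it has three equal conjugates; the norm is then rewritten in terms of \<open>q^3\<close>.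
\<close>
lemma cubic_norm_one_minus_power_cases:
  "cubic_norm (1 - (fps_X :: 'a::idom fps) ^ (3 * m)) = (1 - fps_X ^ m) ^ 3"
  "cubic_norm (1 - (fps_X :: 'a fps) ^ (3 * m + 1)) = 1 - (fps_X :: 'a fps) ^ (3 * m + 1)"
  "cubic_norm (1 - (fps_X :: 'a fps) ^ (3 * m + 2)) = 1 - fps_X ^ (3 * m + 2)"
proof -
  have 0: "1 - (fps_X :: 'a fps) ^ (3 * m) = dilate 3 (1 - fps_X ^ m) + fps_X * dilate 3 0 + fps_X ^ 2 * dilate 3 0"
    by (simp add: dilate_diff dilate_power dilate_X power_mult)
  show "cubic_norm (1 - (fps_X :: 'a fps) ^ (3 * m)) = (1 - fps_X ^ m) ^ 3"
    by (subst 0, subst cubic_norm_decomposed) simp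
  have 1: "1 - (fps_X :: 'a fps) ^ (3 * m + 1) = dilate 3 1 + fps_X * dilate 3 (- (fps_X ^ m)) + fps_X ^ 2 * dilate 3 0"
    by (simp add: dilate_diff dilate_power dilate_X power_mult dilate_uminus)
  show "cubic_norm (1 - (fps_X :: 'a fps) ^ (3 * m + 1)) = 1 - fps_X ^ (3 * m + 1)"
    by (subst 1, subst cubic_norm_decomposed) (simp add: power_mult [symmetric] mult.commute)
  have 2: "1 - (fps_X :: 'a fps) ^ (3 * m + 2) = dilate 3 1 + fps_X * dilate 3 0 + fps_X ^ 2 * dilate 3 (- (fps_X ^ m))"
    by (simp add: dilate_diff dilate_power dilate_X power_mult dilate_uminus power_add
        mult.commute [of "(fps_X ^ 3) ^ m :: 'a fps"] power2_eq_square)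
  show "cubic_norm (1 - (fps_X :: 'a fps) ^ (3 * m + 2)) = 1 - fps_X ^ (3 * m + 2)"
    by (subst 2, subst cubic_norm_decomposed)
      (simp add: power_mult [symmetric] mult.commute power_add, simp add: power2_eq_square)
qed

lemma cubic_norm_one_minus_power:
  assumes "\<not> 3 dvd m"
  shows "cubic_norm (1 - fps_X ^ m) = 1 - fps_X ^ m"
proof -
  have "m mod 3 = 1 \<or> m mod 3 = 2"
    using assms by presburger
  then have "m = 3 * (m div 3) + 1 \<or> m = 3 * (m div 3) + 2"
    by presburger
  then show ?thesis
    using cubic_norm_one_minus_power_cases(2,3)[of "m div 3"] by metis
qed

lemma cubic_norm_1: "cubic_norm 1 = 1"
  using cubic_norm_decomposed[of "1::'a::idom fps" 0 0] by simp

text \<open>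
  In the norm of the product, the factors with exponent prime to \<open>3\<close> are kept and the others
  appear cubed with a third of the exponent. The factors kept are those of \<open>E k\<close> without those of
  \<open>E (3 k)\<close>, and the cubes give \<open>E k ^ 3\<close>.
\<close>
lemma cubic_norm_euler_prod:
  assumes "\<not> 3 dvd k"
  shows "cubic_norm (euler_prod k) * euler_prod (3 * k) = euler_prod k ^ 4"
proof (rule LIMSEQ_unique)
  have k: "k > 0" using assms by (cases k) auto
  show "(\<lambda>N. cubic_norm (euler_partial k (3 * N)) * euler_partial (3 * k) N) \<longlonglongrightarrow>
      cubic_norm (euler_prod k) * euler_prod (3 * k)"
    using k by (intro tendsto_mult_fps tendsto_cubic_norm tendsto_euler_partial tendsto_euler_partial') auto
  have "cubic_norm (euler_partial k (3 * N)) * euler_partial (3 * k) N = euler_partial k (3 * N) * euler_partial k N ^ 3" for N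
  proof (induction N)
    case 0
    then show ?case by (simp add: cubic_norm_1)
  next
    case (Suc N)
    define a b c where "a = 1 - (fps_X::int fps) ^ (k * (3 * N + 1))"
      and "b = 1 - (fps_X::int fps) ^ (k * (3 * N + 2))"
      and "c = 1 - (fps_X::int fps) ^ (k * (3 * N + 3))"
    have S: "euler_partial k (3 * Suc N) = euler_partial k (3 * N) * a * b * c"
      by (simp add: a_def b_def c_def euler_partial_Suc numeral_3_eq_3)
    have S': "euler_partial (3 * k) (Suc N) = euler_partial (3 * k) N * c"
      by (simp add: c_def euler_partial_Suc algebra_simps)
    have "\<not> 3 dvd k * (3 * N + 1)" "\<not> 3 dvd k * (3 * N + 2)"
      using assms prime_dvd_mult_iff[of "3::nat" k "3 * N + 1"]
        prime_dvd_mult_iff[of "3::nat" k "3 * N + 2"] by simp_all presburger+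
    then have ab: "cubic_norm a = a" "cubic_norm b = b"
      unfolding a_def b_def by (blast intro: cubic_norm_one_minus_power)+
    have c: "cubic_norm c = (1 - fps_X ^ (k * Suc N)) ^ 3"
      using cubic_norm_one_minus_power_cases(1)[of "k * Suc N"] by (simp add: c_def algebra_simps)
    have "cubic_norm (euler_partial k (3 * Suc N)) * euler_partial (3 * k) (Suc N) =
        (cubic_norm (euler_partial k (3 * N)) * euler_partial (3 * k) N) * (a * b * c * (1 - fps_X ^ (k * Suc N)) ^ 3)"
      unfolding S S' cubic_norm_mult ab c by (simp only: mult_ac)
    also have "\<dots> = euler_partial k (3 * Suc N) * euler_partial k (Suc N) ^ 3"
      unfolding Suc.IH S euler_partial_Suc[of k N] power_mult_distrib by (simp only: mult_ac)
    finally show ?case .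
  qed
  moreover have "(\<lambda>N. euler_partial k (3 * N) * euler_partial k N ^ 3) \<longlonglongrightarrow> euler_prod k * euler_prod k ^ 3"
    using k by (intro tendsto_mult_fps tendsto_power_fps tendsto_euler_partial tendsto_euler_partial') auto
  ultimately show "(\<lambda>N. cubic_norm (euler_partial k (3 * N)) * euler_partial (3 * k) N) \<longlonglongrightarrow> euler_prod k ^ 4"
    by (simp add: power4_eq_xxxx power3_eq_cube mult.assoc)
qed

section \<open>Gaussian binomials and the finite triple product\<close>

text \<open>
  The Gaussian binomial coefficients, defined by the q-Pascal rule so that they make sense
  in any commutative ring.
\<close>
fun gauss_binomial :: "'a::comm_ring_1 \<Rightarrow> nat \<Rightarrow> nat \<Rightarrow> 'a" where
  "gauss_binomial q n 0 = 1"
| "gauss_binomial q 0 (Suc k) = 0"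
| "gauss_binomial q (Suc n) (Suc k) = gauss_binomial q n k + q ^ Suc k * gauss_binomial q n (Suc k)"

lemma gauss_binomial_eq_0: "n < k \<Longrightarrow> gauss_binomial q n k = 0"
  by (induction q n k rule: gauss_binomial.induct) auto

text \<open>
  The finite q-Pochhammer symbol \<open>(q; q)_n\<close>.
\<close>
definition q_poch :: "'a::comm_ring_1 \<Rightarrow> nat \<Rightarrow> 'a" where
  "q_poch q n = (\<Prod>i<n. 1 - q ^ Suc i)"

lemma q_poch_Suc: "q_poch q (Suc n) = q_poch q n * (1 - q ^ Suc n)"
  by (simp add: q_poch_def)

lemma gauss_binomial_q_poch: "k \<le> n \<Longrightarrow> q_poch q k * q_poch q (n - k) * gauss_binomial q n k = q_poch q n"
proof (induction q n k rule: gauss_binomial.induct)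
  case (1 q n)
  then show ?case by (simp add: q_poch_def)
next
  case (2 q k)
  then show ?case by simp
next
  case (3 q n k)
  have A: "q_poch q k * q_poch q (n - k) * gauss_binomial q n k = q_poch q n"
    using 3 by simp
  show ?case
  proof (cases "k = n")
    case True
    then show ?thesis using A by (simp add: q_poch_Suc gauss_binomial_eq_0 algebra_simps)
  next
    case False
    then have "k < n" using 3 by simp
    then have B: "q_poch q (Suc k) * q_poch q (n - Suc k) * gauss_binomial q n (Suc k) = q_poch q n"
      using 3 by simp
    obtain m where m: "n = Suc (k + m)" using \<open>k < n\<close> less_iff_Suc_add by auto
    have C: "q ^ Suc k * q ^ Suc m = q ^ Suc n" by (simp add: m power_add)
    have A': "q_poch q k * (q_poch q m * (1 - q ^ Suc m)) * gauss_binomial q n k = q_poch q n"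
      using A by (simp add: m Suc_diff_le q_poch_Suc)
    have B': "q_poch q k * (1 - q ^ Suc k) * q_poch q m * gauss_binomial q n (Suc k) = q_poch q n"
      using B by (simp add: m q_poch_Suc)
    have "q_poch q k * (1 - q ^ Suc k) * (q_poch q m * (1 - q ^ Suc m)) *
        (gauss_binomial q n k + q ^ Suc k * gauss_binomial q n (Suc k)) =
        q_poch q k * (q_poch q m * (1 - q ^ Suc m)) * gauss_binomial q n k * (1 - q ^ Suc k) +
        q_poch q k * (1 - q ^ Suc k) * q_poch q m * gauss_binomial q n (Suc k) * (q ^ Suc k * (1 - q ^ Suc m))"
      by (simp only: distrib_left mult_ac)
    also have "\<dots> = q_poch q n * (1 - q ^ Suc k * q ^ Suc m)"
      unfolding A' B' by (simp add: algebra_simps)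
    finally have "q_poch q k * (1 - q ^ Suc k) * (q_poch q m * (1 - q ^ Suc m)) *
        (gauss_binomial q n k + q ^ Suc k * gauss_binomial q n (Suc k)) = q_poch q n * (1 - q ^ Suc k * q ^ Suc m)" .
    then show ?thesis
      using C by (simp add: m q_poch_Suc del: power_Suc)
  qed
qed

text \<open>
  The homogeneous form, with \<open>x\<close> and \<open>y\<close>, makes it possible to substitute powers of \<open>q\<close> for
  both and so to avoid negative powers in the triple product below.
\<close>
lemma gauss_binomial_theorem:
  "(\<Prod>m<n. x + y * q ^ m) = (\<Sum>k\<le>n. gauss_binomial q n k * q ^ (k choose 2) * y ^ k * x ^ (n - k))"
proof (induction n arbitrary: y)
  case 0
  then show ?case by (simp add: binomial_eq_0)
next
  case (Suc n)
  define T where "T = (\<lambda>k. q ^ (Suc k choose 2) * y ^ k * x ^ (n - k))"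
  have ch: "Suc k choose 2 = k + (k choose 2)" for k
    by (simp add: numeral_2_eq_2)
  have "(\<Prod>m<Suc n. x + y * q ^ m) = (x + y) * (\<Prod>m<n. x + (y * q) * q ^ m)"
    by (simp add: prod.lessThan_Suc_shift mult.assoc del: prod.lessThan_Suc)
  also have "\<dots> = (x + y) * (\<Sum>k\<le>n. gauss_binomial q n k * T k)"
    unfolding Suc.IH T_def by (simp add: ch power_add power_mult_distrib algebra_simps)
  also have "\<dots> = (\<Sum>k\<le>n. gauss_binomial q n k * T k * x) + (\<Sum>k\<le>n. gauss_binomial q n k * T k * y)"
    by (simp only: distrib_right [of x y] sum_distrib_right [symmetric] mult.commute,
        simp only: sum_distrib_left)
  also have "(\<Sum>k\<le>n. gauss_binomial q n k * T k * x) = x ^ Suc n + (\<Sum>k<n. gauss_binomial q n (Suc k) * T (Suc k) * x)"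
    by (simp add: T_def binomial_eq_0 lessThan_Suc_atMost[symmetric] sum.lessThan_Suc_shift
        del: sum.lessThan_Suc)
  also have "(\<Sum>k<n. gauss_binomial q n (Suc k) * T (Suc k) * x) =
      (\<Sum>k\<le>n. q ^ Suc k * gauss_binomial q n (Suc k) * q ^ (Suc k choose 2) * y ^ Suc k * x ^ (n - k))"
  proof -
    have "gauss_binomial q n (Suc k) * T (Suc k) * x =
        q ^ Suc k * gauss_binomial q n (Suc k) * q ^ (Suc k choose 2) * y ^ Suc k * x ^ (n - k)" if "k < n" for k
    proof -
      have "n - k = Suc (n - Suc k)" using that by simp
      then show ?thesis by (simp add: T_def ch[of "Suc k"] power_add mult_ac del: binomial_Suc_Suc)
    qed
    then show ?thesis by (simp add: lessThan_Suc_atMost[symmetric] gauss_binomial_eq_0)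
  qed
  also have "x ^ Suc n + \<dots> + (\<Sum>k\<le>n. gauss_binomial q n k * T k * y) =
      x ^ Suc n + (\<Sum>k\<le>n. gauss_binomial q (Suc n) (Suc k) * q ^ (Suc k choose 2) * y ^ Suc k * x ^ (n - k))"
    by (simp add: T_def algebra_simps flip: sum.distrib)
  also have "\<dots> = (\<Sum>k\<le>Suc n. gauss_binomial q (Suc n) k * q ^ (k choose 2) * y ^ k * x ^ (Suc n - k))"
    by (simp add: sum.atMost_Suc_shift binomial_eq_0 del: sum.atMost_Suc gauss_binomial.simps(3) binomial_Suc_Suc)
  finally show ?case .
qed

lemma choose_two_add: "(m + n) choose 2 = (m choose 2) + (n choose 2) + m * n"
  by (induction m) (simp_all add: numeral_2_eq_2)

lemma choose_two_double: "n * n = n + 2 * (n choose 2)"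
  by (induction n) (simp_all add: numeral_2_eq_2)

text \<open>
  This is the finite form of Jacobi's identity. Taking \<open>x = q ^ N\<close> and \<open>y = a\<close> in the
  q-binomial theorem with \<open>2 N\<close> factors, the upper half of the factors is \<open>q ^ N (1 + a q ^ i)\<close> and,
  because \<open>q = a b\<close>, the lower half is \<open>a q ^ m (1 + b q ^ (N - m - 1))\<close>. The monomial in front is
  cancelled at the end. The index \<open>k\<close> stands for \<open>N + j\<close> with \<open>-N \<le> j \<le> N\<close>.
\<close>
lemma finite_triple_product:
  fixes a b :: "'a::idom"
  assumes ab: "a \<noteq> 0" "b \<noteq> 0"
  defines "q \<equiv> a * b"
  shows "(\<Prod>i<N. (1 + a * q ^ i) * (1 + b * q ^ i)) =
    (\<Sum>k\<le>2*N. gauss_binomial q (2*N) k * (if N \<le> k then a ^ (k - N) * q ^ ((k - N) choose 2)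
       else b ^ (N - k) * q ^ ((N - k) choose 2)))" (is "?L = (\<Sum>k\<le>2*N. _ * ?t k)")
proof -
  \<comment> \<open>the monomial by which the q-binomial theorem differs from the claim\<close>
  define M where "M = q ^ (N * N) * a ^ N * q ^ (N choose 2)"
  have M: "M \<noteq> 0" using ab by (simp add: M_def q_def)
  have low: "(\<Prod>m<N. q ^ N + a * q ^ m) = a ^ N * q ^ (N choose 2) * (\<Prod>i<N. 1 + b * q ^ i)"
  proof -
    have "(\<Prod>m<N. q ^ N + a * q ^ m) = (\<Prod>m<N. a * q ^ m * (1 + b * q ^ (N - Suc m)))"
    proof (rule prod.cong)
      fix m assume "m \<in> {..<N}"
      then have "q ^ N = q * q ^ m * q ^ (N - Suc m)"
        by (simp flip: power_add power_Suc)
      then show "q ^ N + a * q ^ m = a * q ^ m * (1 + b * q ^ (N - Suc m))"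
        by (simp add: q_def algebra_simps)
    qed simp
    also have "\<dots> = a ^ N * (\<Prod>m<N. q ^ m) * (\<Prod>m<N. 1 + b * q ^ (N - Suc m))"
      by (simp add: prod.distrib)
    also have "(\<Prod>m<N. 1 + b * q ^ (N - Suc m)) = (\<Prod>i<N. 1 + b * q ^ i)"
      by (rule prod.nat_diff_reindex)
    also have "(\<Prod>m<N. q ^ m) = q ^ (N choose 2)"
      by (induction N) (simp_all add: numeral_2_eq_2 power_add mult.commute)
    finally show ?thesis .
  qed
  have high: "(\<Prod>m\<in>{N..<2*N}. q ^ N + a * q ^ m) = q ^ (N * N) * (\<Prod>i<N. 1 + a * q ^ i)"
  proof -
    have "(\<Prod>m\<in>{N..<2*N}. q ^ N + a * q ^ m) = (\<Prod>i<N. q ^ N + a * q ^ (i + N))"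
      using prod.shift_bounds_nat_ivl[of "\<lambda>m. q ^ N + a * q ^ m" 0 N N]
      by (simp add: lessThan_atLeast0 mult_2)
    also have "\<dots> = (\<Prod>i<N. q ^ N * (1 + a * q ^ i))"
      by (simp add: power_add algebra_simps)
    finally show ?thesis
      by (simp add: prod.distrib power_mult)
  qed
  have "M * ?L = (\<Prod>m<N. q ^ N + a * q ^ m) * (\<Prod>m\<in>{N..<2*N}. q ^ N + a * q ^ m)"
    unfolding low high by (simp add: M_def prod.distrib mult_ac)
  also have "\<dots> = (\<Prod>m<2*N. q ^ N + a * q ^ m)"
    using prod.atLeastLessThan_concat[of 0 N "2*N"] by (simp add: lessThan_atLeast0)
  also have "\<dots> = (\<Sum>k\<le>2*N. gauss_binomial q (2*N) k * q ^ (k choose 2) * a ^ k * (q ^ N) ^ (2*N - k))"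
    by (rule gauss_binomial_theorem)
  also have "\<dots> = (\<Sum>k\<le>2*N. M * (gauss_binomial q (2*N) k * ?t k))"
  proof (rule sum.cong)
    fix k assume k: "k \<in> {..2*N}"
    have "q ^ (k choose 2) * a ^ k * (q ^ N) ^ (2*N - k) = M * ?t k"
    \<comment> \<open>compare the exponents of \<open>q\<close>; for \<open>k < N\<close>, with \<open>N = k + j\<close>, split off \<open>q ^ j = a ^ j * b ^ j\<close> first\<close>
    proof (cases "N \<le> k")
      case True
      then obtain j where j: "k = N + j" by (auto simp: le_iff_add)
      with k obtain l where l: "N = j + l" by (auto simp: le_iff_add)
      have e: "(k choose 2) + N * (2*N - k) = N * N + (N choose 2) + (j choose 2)"
        unfolding j choose_two_add by (simp add: l algebra_simps)
      have "q ^ (k choose 2) * a ^ k * (q ^ N) ^ (2*N - k) = a ^ k * q ^ ((k choose 2) + N * (2*N - k))"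
        by (simp add: power_add power_mult mult_ac)
      also have "\<dots> = M * ?t k"
        unfolding e by (simp add: M_def j power_add mult_ac)
      finally show ?thesis .
    next
      case False
      then obtain j where j: "N = k + j" by (auto simp: not_le dest: less_imp_add_positive)
      with False have "j > 0" by simp
      have e: "(k choose 2) + N * (2*N - k) = N * N + (N choose 2) + (j choose 2) + j"
        unfolding j choose_two_add using choose_two_double[of j] by (simp add: algebra_simps)
      have "q ^ (k choose 2) * a ^ k * (q ^ N) ^ (2*N - k) = a ^ k * q ^ ((k choose 2) + N * (2*N - k))"
        by (simp add: power_add power_mult mult_ac)
      also have "\<dots> = a ^ k * q ^ (N * N + (N choose 2) + (j choose 2)) * (a * b) ^ j"
        unfolding e by (simp add: power_add q_def mult_ac)
      also have "\<dots> = M * ?t k"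
        using \<open>j > 0\<close> by (simp add: M_def j power_add power_mult_distrib mult_ac)
      finally show ?thesis .
    qed
    then show "gauss_binomial q (2*N) k * q ^ (k choose 2) * a ^ k * (q ^ N) ^ (2*N - k) =
        M * (gauss_binomial q (2*N) k * ?t k)"
      by (simp add: mult_ac)
  qed simp
  finally show ?thesis
    using M by (simp flip: sum_distrib_left)
qed

section \<open>Theta series\<close>

text \<open>
  The series \<open>\<Sum> j. w j * q ^ e j\<close> over all integers \<open>j\<close>. The definition is only meaningful
  if \<open>e\<close> takes each value finitely often. Exponents are integers so that they can be quadratic
  polynomials in \<open>j\<close> without truncation.
\<close>
definition theta :: "(int \<Rightarrow> int) \<Rightarrow> (int \<Rightarrow> int) \<Rightarrow> int fps" where
  "theta w e = Abs_fps (\<lambda>n. \<Sum>j | e j = int n. w j)"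

lemma theta_nth: "fps_nth (theta w e) n = (\<Sum>j | e j = int n. w j)"
  by (simp add: theta_def)

lemma theta_reindex:
  assumes "bij h"
  shows "theta (\<lambda>j. w (h j)) (\<lambda>j. e (h j)) = theta w e"
proof (rule fps_ext)
  fix n
  have "(\<Sum>j | e (h j) = int n. w (h j)) = (\<Sum>j | e j = int n. w j)"
    using assms
    by (intro sum.reindex_bij_witness[of _ "inv h" h])
      (auto simp: bij_is_inj bij_is_surj surj_f_inv_f)
  then show "fps_nth (theta (\<lambda>j. w (h j)) (\<lambda>j. e (h j))) n = fps_nth (theta w e) n"
    by (simp add: theta_nth)
qed

lemma theta_scale:
  assumes "k > 0"
  shows "theta w (\<lambda>j. int k * e j) = dilate k (theta w e)"
proof (rule fps_ext)
  fix n
  show "fps_nth (theta w (\<lambda>j. int k * e j)) n = fps_nth (dilate k (theta w e)) n"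
  proof (cases "k dvd n")
    case True
    then obtain m where "n = k * m" by blast
    then show ?thesis using assms by (simp add: theta_nth dilate_nth)
  next
    case False
    then have "{j. int k * e j = int n} = {}"
      by (metis (mono_tags, lifting) dvd_triv_left empty_Collect_eq int_dvd_int_iff)
    then have "fps_nth (theta w (\<lambda>j. int k * e j)) n = 0"
      by (simp only: theta_nth sum.empty)
    then show ?thesis using False assms by (simp add: dilate_nth)
  qed
qed

lemma theta_shift:
  assumes "\<And>j. e j \<ge> 0"
  shows "theta w (\<lambda>j. e j + 1) = fps_X * theta w e"
proof (rule fps_ext)
  fix n
  show "fps_nth (theta w (\<lambda>j. e j + 1)) n = fps_nth (fps_X * theta w e) n"
  proof (cases n)
    case 0
    have "e j + 1 \<noteq> 0" for j using assms[of j] by simp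
    then show ?thesis using 0 by (simp add: theta_nth)
  next
    case (Suc m)
    then show ?thesis by (simp add: theta_nth add.commute)
  qed
qed

lemma theta_uminus: "theta (\<lambda>j. - w j) e = - theta w e"
  by (rule fps_ext) (simp add: theta_nth sum_negf)

text \<open>
  Collecting the index by residue classes is the source of all dissections of theta functions.
\<close>
lemma theta_split:
  assumes m: "m > 0" and fin: "\<And>n. finite {j. e j = int n}"
  shows "theta w e = (\<Sum>r<m. theta (\<lambda>i. w (int m * i + int r)) (\<lambda>i. e (int m * i + int r)))"
proof (rule fps_ext)
  fix n
  define S where "S = {j. e j = int n}"
  define T where "T = (\<lambda>r. {i. e (int m * i + int r) = int n})"
  have "bij_betw (\<lambda>(r, i). int m * i + int r) (Sigma {..<m} T) S"
  proof (rule bij_betwI[where g = "\<lambda>j. (nat (j mod int m), j div int m)"])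
    show "(\<lambda>j. (nat (j mod int m), j div int m)) \<in> S \<rightarrow> Sigma {..<m} T"
      using m by (auto simp: S_def T_def nat_less_iff)
    show "(\<lambda>(r, i). int m * i + int r) \<in> Sigma {..<m} T \<rightarrow> S"
      by (auto simp: S_def T_def)
  qed (use m in auto)
  then have "(\<Sum>j\<in>S. w j) = (\<Sum>(r, i)\<in>Sigma {..<m} T. w (int m * i + int r))"
    by (simp add: sum.reindex_bij_betw [symmetric] case_prod_unfold)
  also have "\<dots> = (\<Sum>r<m. \<Sum>i\<in>T r. w (int m * i + int r))"
  proof (rule sum.Sigma [symmetric])
    show "\<forall>r\<in>{..<m}. finite (T r)"
    proof
      fix r
      have "inj_on (\<lambda>i. int m * i + int r) (T r)" using m by (simp add: inj_on_def)
      moreover have "(\<lambda>i. int m * i + int r) ` T r \<subseteq> S" by (auto simp: S_def T_def)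
      ultimately show "finite (T r)"
        using fin[of n] S_def by (metis inj_on_finite)
    qed
  qed simp
  finally show "fps_nth (theta w e) n =
      fps_nth (\<Sum>r<m. theta (\<lambda>i. w (int m * i + int r)) (\<lambda>i. e (int m * i + int r))) n"
    by (simp add: theta_nth fps_sum_nth S_def T_def)
qed

text \<open>
  The exponent of \<open>q\<close> in the term \<open>a^(j (j + 1) / 2) * b^(j (j - 1) / 2)\<close> of Ramanujan's theta
  function \<open>f(a, b)\<close> at \<open>a = \<plusminus>q ^ r\<close> and \<open>b = \<plusminus>q ^ t\<close>; replacing \<open>j\<close> by \<open>-j\<close> exchanges \<open>r\<close> and \<open>t\<close>.
\<close>
definition theta_exp :: "nat \<Rightarrow> nat \<Rightarrow> int \<Rightarrow> int" where
  "theta_exp r t j = int r * j + int (r + t) * (j * (j - 1) div 2)"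

text \<open>
  For \<open>s = \<plusminus>1\<close> this is \<open>s ^ \<bar>j\<bar>\<close>.
\<close>
definition theta_sign :: "int \<Rightarrow> int \<Rightarrow> int" where
  "theta_sign s j = (if even j then 1 else s)"

lemma two_theta_exp: "2 * theta_exp r t j = 2 * int r * j + int (r + t) * (j * (j - 1))"
proof -
  have "even (j * (j - 1))" by simp
  then have "2 * (j * (j - 1) div 2) = j * (j - 1)" by simp
  then show ?thesis unfolding theta_exp_def by (simp add: algebra_simps)
qed

lemma theta_exp_nonneg_index: "theta_exp r t (int j) = int (r * j + (r + t) * (j choose 2))"
proof -
  have "2 * int (r * j + (r + t) * (j choose 2)) = 2 * theta_exp r t (int j)"
    unfolding two_theta_exp using choose_two_double[of j, THEN arg_cong[of _ _ int]]
    by (simp add: algebra_simps)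
  then show ?thesis by simp
qed

lemma theta_exp_neg_index: "theta_exp r t (- int j) = int (t * j + (r + t) * (j choose 2))"
proof -
  have "2 * int (t * j + (r + t) * (j choose 2)) = 2 * theta_exp r t (- int j)"
    unfolding two_theta_exp using choose_two_double[of j, THEN arg_cong[of _ _ int]]
    by (simp add: algebra_simps)
  then show ?thesis by simp
qed

lemma theta_exp_ge:
  assumes "r > 0" "t > 0"
  shows "\<bar>j\<bar> \<le> theta_exp r t j"
proof (cases "j \<ge> 0")
  case True
  then obtain n where "j = int n" by (metis nonneg_int_cases)
  moreover have "n \<le> r * n + (r + t) * (n choose 2)" using assms by (simp add: trans_le_add1)
  ultimately show ?thesis by (simp add: theta_exp_nonneg_index del: of_nat_add of_nat_mult)
next
  case False
  then obtain n where "j = - int n" by (metis int_cases2 of_nat_0_le_iff)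
  moreover have "n \<le> t * n + (r + t) * (n choose 2)" using assms by (simp add: trans_le_add1)
  ultimately show ?thesis by (simp add: theta_exp_neg_index del: of_nat_add of_nat_mult)
qed

lemma finite_theta_exp:
  assumes "r > 0" "t > 0"
  shows "finite {j. theta_exp r t j = int n}"
proof (rule finite_subset)
  show "{j. theta_exp r t j = int n} \<subseteq> {- int n..int n}"
  proof
    fix j assume "j \<in> {j. theta_exp r t j = int n}"
    then show "j \<in> {- int n..int n}" using theta_exp_ge[OF assms, of j] by auto
  qed
qed simp

section \<open>Jacobi's triple product\<close>

lemma q_poch_dvd_diff: "m \<le> n \<Longrightarrow> q ^ Suc m dvd q_poch q n - q_poch q m"
proof (induction rule: dec_induct)
  case (step n)
  have "q_poch q (Suc n) - q_poch q m = (q_poch q n - q_poch q m) - q ^ Suc n * q_poch q n"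
    by (simp add: q_poch_Suc algebra_simps)
  moreover have "q ^ Suc m dvd q ^ Suc n * q_poch q n"
    using step by (intro dvd_mult2 le_imp_power_dvd) simp
  ultimately show ?case using step.IH by (metis dvd_diff)
qed simp

text \<open>
  As \<open>N\<close> grows, the coefficients of the finite triple product, times \<open>(q; q)_N\<close>, tend to \<open>1\<close>: by the
  factorial formula the binomial is a quotient of Pochhammer symbols, all of which agree with
  \<open>U = (q; q)_(N - j)\<close> up to order \<open>q ^ (N - j)\<close>.
\<close>
lemma q_poch_gauss_binomial_central:
  fixes q :: "'a::comm_ring_1 fps"
  assumes q: "fps_nth q 0 = 0" and j: "j \<le> N" and k: "k = N + j \<or> k = N - j"
  shows "q ^ Suc (N - j) dvd q_poch q N * gauss_binomial q (2 * N) k - 1"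
proof -
  define m where "m = N - j"
  define U where "U = q_poch q m"
  define B where "B = gauss_binomial q (2 * N) k"
  have "fps_nth (q_poch q n) 0 = 1" for n
    using q by (induction n) (simp_all add: q_poch_def)
  then have "fps_left_inverse U 1 * U = 1"
    by (simp add: U_def fps_left_inverse)
  then obtain V where V: "V * U = 1" by blast
  have "q_poch q (N + j) * q_poch q (N - j) * B = q_poch q (2 * N)"
    using k j gauss_binomial_q_poch[of k "2 * N" q] by (auto simp: B_def mult_2 mult.commute)
  then have BU: "q_poch q (N + j) * U * B = q_poch q (2 * N)"
    by (simp add: U_def m_def)
  have dvd: "q ^ Suc m dvd q_poch q n - U" if "n \<ge> m" for n
    unfolding U_def using that by (rule q_poch_dvd_diff)
  \<comment> \<open>replacing every Pochhammer symbol by \<open>U\<close> yields \<open>U * U * B = U\<close> up to order \<open>m\<close>; cancel the unit \<open>U\<close>\<close>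
  have "q ^ Suc m dvd (q_poch q (2 * N) - U) - (q_poch q (N + j) - U) * (U * B)"
    by (intro dvd_diff dvd_mult2 dvd) (auto simp: m_def)
  also have "(q_poch q (2 * N) - U) - (q_poch q (N + j) - U) * (U * B) = U * (U * B - 1)"
    using BU by (simp add: algebra_simps)
  finally have "q ^ Suc m dvd V * (U * (U * B - 1))" by (rule dvd_mult)
  moreover have "V * (U * (U * B - 1)) = U * B - 1"
    using V by (simp flip: mult.assoc)
  ultimately have "q ^ Suc m dvd U * B - 1" by simp
  then have "q ^ Suc m dvd (q_poch q N - U) * B + (U * B - 1)"
    by (intro dvd_add dvd_mult2 dvd) (auto simp: m_def)
  then show ?thesis by (simp add: m_def B_def algebra_simps)
qed

definition triple_partial :: "int \<Rightarrow> nat \<Rightarrow> nat \<Rightarrow> nat \<Rightarrow> int fps" where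
  "triple_partial s r t N = (\<Prod>i<N. (1 + fps_const s * fps_X ^ (r + (r + t) * i)) *
      (1 + fps_const s * fps_X ^ (t + (r + t) * i)) * (1 - fps_X ^ ((r + t) * Suc i)))"

lemma triple_partial_0 [simp]: "triple_partial s r t 0 = 1"
  by (simp add: triple_partial_def)

text \<open>
  The limit of the finite identity with \<open>a = s q ^ r\<close> and \<open>b = s q ^ t\<close>. At a fixed exponent \<open>n\<close> only
  indices \<open>\<bar>j\<bar> \<le> n\<close> contribute, and for \<open>N \<ge> 2 n\<close> their coefficients, multiplied by the factor \<open>(q; q)_N\<close> of the
  partial product, are \<open>1\<close> up to order \<open>n\<close>.
\<close>
lemma jacobi_triple_product:
  assumes rt: "r > 0" "t > 0" and s: "s = 1 \<or> s = -1"
  shows "triple_partial s r t \<longlonglongrightarrow> theta (theta_sign s) (theta_exp r t)"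
proof (rule tendsto_fpsI)
  fix n
  define a b q :: "int fps" where "a = fps_const s * fps_X ^ r" and "b = fps_const s * fps_X ^ t"
    and "q = fps_X ^ (r + t)"
  have ss: "s * s = 1" using s by auto
  have q: "q = a * b"
  proof -
    have "a * b = (fps_const s * fps_const s) * (fps_X ^ r * fps_X ^ t)"
      by (simp only: a_def b_def mult_ac)
    then show ?thesis by (simp add: ss q_def power_add)
  qed
  have qp: "q ^ i = fps_X ^ ((r + t) * i)" for i by (simp add: q_def power_mult)
  have ab: "a \<noteq> 0" "b \<noteq> 0" using s by (auto simp: a_def b_def)
  define tt where "tt = (\<lambda>N k. if N \<le> k then a ^ (k - N) * q ^ ((k - N) choose 2)
       else b ^ (N - k) * q ^ ((N - k) choose 2))"
  have spow: "s ^ j = theta_sign s (int j)" for j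
    using s by (auto simp: theta_sign_def)
  have tt: "tt N (nat (int N + j)) = fps_const (theta_sign s j) * fps_X ^ nat (theta_exp r t j)"
    if "int N + j \<ge> 0" for N j
  proof (cases "j \<ge> 0")
    case True
    then obtain l where l: "j = int l" by (metis nonneg_int_cases)
    then have "nat (int N + j) = N + l" by simp
    then show ?thesis
      by (simp add: l tt_def theta_exp_nonneg_index a_def q_def power_mult_distrib power_add
          fps_const_power spow distrib_right del: of_nat_add of_nat_mult flip: power_mult)
  next
    case False
    then obtain l where l: "j = - int l" "l > 0" by (metis int_cases2 neg_0_le_iff_le of_nat_0_less_iff not_le of_nat_0_le_iff)
    with that have "nat (int N + j) = N - l" "l \<le> N" "\<not> N \<le> N - l" by auto
    moreover have "theta_sign s (int l) = theta_sign s j" by (simp add: l theta_sign_def)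
    ultimately show ?thesis using l(2)
      by (simp add: l(1) tt_def theta_exp_neg_index b_def q_def power_mult_distrib power_add
          fps_const_power spow distrib_right del: of_nat_add of_nat_mult flip: power_mult)
  qed
  have tt': "tt N k = fps_const (theta_sign s (int k - int N)) *
      fps_X ^ nat (theta_exp r t (int k - int N))" for N k
    using tt[of N "int k - int N"] by simp
  have "fps_nth (triple_partial s r t N) n =
    fps_nth (theta (theta_sign s) (theta_exp r t)) n" if N: "N \<ge> 2 * n" for N
  proof -
    have "triple_partial s r t N =
      (\<Prod>i<N. (1 + a * q ^ i) * (1 + b * q ^ i)) * q_poch q N"
      by (simp only: triple_partial_def prod.distrib q_poch_def qp a_def b_def power_add mult.assoc)
    also have "\<dots> = (\<Sum>k\<le>2*N. q_poch q N * gauss_binomial q (2*N) k * tt N k)"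
      unfolding q finite_triple_product[OF ab] tt_def by (simp add: sum_distrib_left mult_ac)
    also have "\<dots> = (\<Sum>j\<in>{-int N..int N}. q_poch q N * gauss_binomial q (2*N) (nat (int N + j)) *
        (fps_const (theta_sign s j) * fps_X ^ nat (theta_exp r t j)))"
      by (rule sum.reindex_bij_witness[of _ "\<lambda>j. nat (int N + j)" "\<lambda>k. int k - int N"])
        (auto simp: tt')
    finally have "fps_nth (triple_partial s r t N) n =
      (\<Sum>j\<in>{-int N..int N}. fps_nth (q_poch q N * gauss_binomial q (2*N) (nat (int N + j)) *
        (fps_const (theta_sign s j) * fps_X ^ nat (theta_exp r t j))) n)"
      by (simp add: fps_sum_nth)
    also have "\<dots> = (\<Sum>j\<in>{-int N..int N}. if theta_exp r t j = int n then theta_sign s j else 0)"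
    proof (rule sum.cong)
      fix j assume j: "j \<in> {-int N..int N}"
      define c where "c = q_poch q N * gauss_binomial q (2*N) (nat (int N + j))"
      have ge: "\<bar>j\<bar> \<le> theta_exp r t j" by (rule theta_exp_ge[OF rt])
      have "fps_nth (c * (fps_const (theta_sign s j) * fps_X ^ nat (theta_exp r t j))) n =
          (if theta_exp r t j = int n then theta_sign s j else 0)"
      proof (cases "theta_exp r t j \<le> int n")
        case True
        define l where "l = nat \<bar>j\<bar>"
        have l: "l \<le> n" "l \<le> N" using True ge N by (auto simp: l_def)
        have k: "nat (int N + j) = N + l \<or> nat (int N + j) = N - l"
          using j by (auto simp: l_def)
        \<comment> \<open>the index is close enough to the centre for the coefficient to be \<open>1\<close> up to order \<open>n\<close>\<close>
        have "fps_X ^ Suc n dvd q ^ Suc (N - l)"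
        proof -
          have "Suc n \<le> 1 * Suc (N - l)" using N l by simp
          also have "\<dots> \<le> (r + t) * Suc (N - l)" using rt by (intro mult_le_mono1) simp
          finally show ?thesis unfolding q_def power_mult [symmetric] by (rule le_imp_power_dvd)
        qed
        also have "q ^ Suc (N - l) dvd c - 1"
          unfolding c_def using rt by (intro q_poch_gauss_binomial_central l k) (simp add: q_def)
        finally obtain h where "c - 1 = fps_X ^ Suc n * h" by blast
        then have c: "c = 1 + fps_X ^ Suc n * h" by (simp add: algebra_simps)
        have "c * (fps_const (theta_sign s j) * fps_X ^ nat (theta_exp r t j)) =
            fps_const (theta_sign s j) * fps_X ^ nat (theta_exp r t j) +
            fps_X ^ Suc n * (h * (fps_const (theta_sign s j) * fps_X ^ nat (theta_exp r t j)))"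
          unfolding c by (simp add: algebra_simps)
        then show ?thesis using ge
          by (auto simp: fps_X_power_mult_nth simp del: power_Suc)
      next
        case False
        then have "n < nat (theta_exp r t j)" by simp
        then show ?thesis using False
          by (simp add: fps_X_power_mult_right_nth flip: mult.assoc)
      qed
      then show "fps_nth (q_poch q N * gauss_binomial q (2*N) (nat (int N + j)) *
          (fps_const (theta_sign s j) * fps_X ^ nat (theta_exp r t j))) n =
          (if theta_exp r t j = int n then theta_sign s j else 0)"
        by (simp only: c_def)
    qed simp
    also have "\<dots> = (\<Sum>j\<in>{j\<in>{-int N..int N}. theta_exp r t j = int n}. theta_sign s j)"
      by (rule sum.inter_filter [symmetric]) simp
    also have "{j\<in>{-int N..int N}. theta_exp r t j = int n} = {j. theta_exp r t j = int n}"
    proof -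
      have "- int N \<le> j \<and> j \<le> int N" if "theta_exp r t j = int n" for j
        using theta_exp_ge[OF rt, of j] that N by linarith
      then show ?thesis by auto
    qed
    finally show ?thesis by (simp add: theta_nth)
  qed
  then show "eventually (\<lambda>N. fps_nth (triple_partial s r t N) n =
    fps_nth (theta (theta_sign s) (theta_exp r t)) n) sequentially"
    by (auto simp: eventually_sequentially)
qed

section \<open>Product formulas for theta functions\<close>

abbreviation E :: "nat \<Rightarrow> int fps" where "E \<equiv> euler_prod"

text \<open>
  The theta functions \<open>psi = \<Sum> q ^ (n (n + 1) / 2)\<close> over \<open>n \<ge> 0\<close> and \<open>phi = \<Sum> (-1) ^ j q ^ (j ^ 2)\<close> over
  all integers \<open>j\<close>, and the theta functions that occur in their dissections modulo \<open>3\<close>.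
\<close>
definition psi :: "int fps" where "psi = theta (theta_sign 1) (theta_exp 1 3)"
definition phi :: "int fps" where "phi = theta (theta_sign (-1)) (theta_exp 1 1)"
definition psi_part :: "int fps" where "psi_part = theta (theta_sign 1) (theta_exp 1 2)"
definition phi_part :: "int fps" where "phi_part = theta (theta_sign (-1)) (theta_exp 1 5)"

lemma fps_const_minus_one [simp]: "fps_const (-1) = (-1 :: int fps)"
  by (simp flip: fps_const_neg)

lemma lessThan_nat_1: "{..<1::nat} = {0}"
  by auto

text \<open>
  In this and the next lemma the step of an induction on \<open>N\<close> multiplies by a polynomial in \<open>X\<close> and
  \<open>X ^ N\<close>. Identities between products thereby reduce to polynomial identities in \<open>x = X\<close> and
  \<open>z = X ^ N\<close>. Products that gain one factor per step are the case \<open>c = 1\<close> of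
  the second lemma, with length \<open>1 * N\<close>.
\<close>
lemma triple_partial_step: "triple_partial s r t (Suc N) = triple_partial s r t N *
    ((1 + fps_const s * ((fps_X ^ N) ^ (r + t) * fps_X ^ r)) *
     (1 + fps_const s * ((fps_X ^ N) ^ (r + t) * fps_X ^ t)) *
     (1 - (fps_X ^ N) ^ (r + t) * fps_X ^ (r + t)))"
proof -
  have "fps_X ^ (c + (r + t) * N) = (fps_X ^ N) ^ (r + t) * (fps_X :: int fps) ^ c" for c
    by (metis mult.commute power_add power_mult)
  then show ?thesis
    unfolding triple_partial_def prod.lessThan_Suc mult_Suc_right by (simp only:)
qed

lemma euler_partial_step: "euler_partial k (c * Suc N) =
    euler_partial k (c * N) * (\<Prod>i<c. 1 - (fps_X ^ N) ^ (k * c) * fps_X ^ (k * (i + 1)))"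
proof -
  have "euler_partial k (M + c) = euler_partial k M * (\<Prod>i<c. 1 - fps_X ^ (k * (M + i + 1)))" for M
    by (induction c) (simp_all add: euler_partial_Suc mult.assoc)
  moreover have "(fps_X :: int fps) ^ (k * (c * N + i + 1)) = (fps_X ^ N) ^ (k * c) * fps_X ^ (k * (i + 1))" for i
  proof -
    have "k * (c * N + i + 1) = N * (k * c) + k * (i + 1)" by (simp add: algebra_simps)
    then show ?thesis by (simp only: power_add power_mult)
  qed
  ultimately show ?thesis
    by (simp only: mult_Suc_right add.commute [of c "c * N"])
qed

text \<open>
  Every positive integer is \<open>0\<close>, \<open>1\<close> or \<open>2\<close> modulo \<open>3\<close>, so here the triple product consists of
  exactly the factors of \<open>E 1\<close>: this is Euler's pentagonal number theorem.
\<close>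
lemma pentagonal: "E 1 = theta (theta_sign (-1)) (theta_exp 1 2)"
proof (rule LIMSEQ_unique)
  show "(\<lambda>N. euler_partial 1 (3 * N)) \<longlonglongrightarrow> E 1"
    by (intro tendsto_euler_partial) auto
  have "euler_partial 1 (3 * N) = triple_partial (-1) 1 2 N" for N
  proof (induction N)
    case (Suc N)
    show ?case
      unfolding triple_partial_step euler_partial_step Suc.IH by (simp add: lessThan_nat_numeral lessThan_nat_1 mult_ac del: One_nat_def power_Suc)
  qed simp
  then show "(\<lambda>N. euler_partial 1 (3 * N)) \<longlonglongrightarrow> theta (theta_sign (-1)) (theta_exp 1 2)"
    using jacobi_triple_product[of 1 2 "-1"] by simp
qed

text \<open>
  The triple product gives \<open>psi\<close> as the product of the \<open>1 + q ^ m\<close> over odd \<open>m\<close>, times \<open>E 4\<close>. Writing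
  \<open>1 + q ^ m = (1 - q ^ (2 m)) / (1 - q ^ m)\<close> turns it into the quotient \<open>E 2 ^ 2 / E 1\<close>. The factor \<open>E 4\<close> on
  both sides completes the products over odd \<open>m\<close> to products over all \<open>m\<close>. In the finite version the exponents
  \<open>m \<le> 4 N\<close> occur, together with \<open>2 m\<close> in the factors that come from \<open>1 + q ^ m\<close>; this fixes the lengths.
\<close>
lemma psi_product: "psi * (E 1 * E 4) = E 2 * E 2 * E 4"
proof (rule LIMSEQ_unique)
  show "(\<lambda>N. triple_partial 1 1 3 N * (euler_partial 1 (4 * N) * euler_partial 4 (2 * N))) \<longlonglongrightarrow> psi * (E 1 * E 4)"
    unfolding psi_def
    by (intro tendsto_mult_fps tendsto_power_fps tendsto_euler_partial jacobi_triple_product) auto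
  have "triple_partial 1 1 3 N * (euler_partial 1 (4 * N) * euler_partial 4 (2 * N)) = euler_partial 2 (4 * N) * euler_partial 2 (2 * N) * euler_partial 4 (1 * N)" for N
  proof (induction N)
    case (Suc N)
    define z x where "z = (fps_X :: int fps) ^ N" and "x = (fps_X :: int fps)"
    have 1: "triple_partial 1 1 3 (Suc N) = triple_partial 1 1 3 N *
        ((1 + z^4 * x) * (1 + z^4 * x^3) * (1 - z^4 * x^4))"
      by (simp add: triple_partial_step z_def x_def del: One_nat_def power_Suc)
    have 2: "euler_partial 1 (4 * Suc N) = euler_partial 1 (4 * N) * ((1 - z^4 * x) * (1 - z^4 * x^2) * (1 - z^4 * x^3) * (1 - z^4 * x^4))"
      unfolding euler_partial_step by (simp add: z_def x_def lessThan_nat_numeral lessThan_nat_1 mult_ac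
        del: One_nat_def power_Suc)
    have 3: "euler_partial 2 (2 * Suc N) = euler_partial 2 (2 * N) * ((1 - z^4 * x^2) * (1 - z^4 * x^4))"
      unfolding euler_partial_step by (simp add: z_def x_def lessThan_nat_numeral lessThan_nat_1 mult_ac
        del: One_nat_def power_Suc)
    have 4: "euler_partial 2 (4 * Suc N) = euler_partial 2 (4 * N) * ((1 - z^8 * x^2) * (1 - z^8 * x^4) * (1 - z^8 * x^6) * (1 - z^8 * x^8))"
      unfolding euler_partial_step by (simp add: z_def x_def lessThan_nat_numeral lessThan_nat_1 mult_ac
        del: One_nat_def power_Suc)
    have 5: "euler_partial 4 (1 * Suc N) = euler_partial 4 (1 * N) * (1 - z^4 * x^4)"
      unfolding euler_partial_step by (simp add: z_def x_def lessThan_nat_numeral lessThan_nat_1 mult_ac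
        del: One_nat_def power_Suc)
    have 6: "euler_partial 4 (2 * Suc N) = euler_partial 4 (2 * N) * ((1 - z^8 * x^4) * (1 - z^8 * x^8))"
      unfolding euler_partial_step by (simp add: z_def x_def lessThan_nat_numeral lessThan_nat_1 mult_ac
        del: One_nat_def power_Suc)
    show ?case unfolding 1 2 3 4 5 6 using Suc.IH by algebra
  qed simp
  moreover have "(\<lambda>N. euler_partial 2 (4 * N) * euler_partial 2 (2 * N) * euler_partial 4 (1 * N)) \<longlonglongrightarrow> E 2 * E 2 * E 4"
    by (intro tendsto_mult_fps tendsto_power_fps tendsto_euler_partial) auto
  ultimately show "(\<lambda>N. triple_partial 1 1 3 N * (euler_partial 1 (4 * N) * euler_partial 4 (2 * N))) \<longlonglongrightarrow> E 2 * E 2 * E 4"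
    by simp
qed

lemma phi_product: "phi * E 2 = E 1 ^ 2"
proof (rule LIMSEQ_unique)
  show "(\<lambda>N. triple_partial (-1) 1 1 N * (euler_partial 2 (1 * N))) \<longlonglongrightarrow> phi * E 2"
    unfolding phi_def
    by (intro tendsto_mult_fps tendsto_power_fps tendsto_euler_partial jacobi_triple_product) auto
  have "triple_partial (-1) 1 1 N * (euler_partial 2 (1 * N)) = euler_partial 1 (2 * N) ^ 2" for N
  proof (induction N)
    case (Suc N)
    define z x where "z = (fps_X :: int fps) ^ N" and "x = (fps_X :: int fps)"
    have 1: "triple_partial (-1) 1 1 (Suc N) = triple_partial (-1) 1 1 N *
        ((1 - z^2 * x) * (1 - z^2 * x) * (1 - z^2 * x^2))"
      by (simp add: triple_partial_step z_def x_def del: One_nat_def power_Suc)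
    have 2: "euler_partial 1 (2 * Suc N) = euler_partial 1 (2 * N) * ((1 - z^2 * x) * (1 - z^2 * x^2))"
      unfolding euler_partial_step by (simp add: z_def x_def lessThan_nat_numeral lessThan_nat_1 mult_ac
        del: One_nat_def power_Suc)
    have 3: "euler_partial 2 (1 * Suc N) = euler_partial 2 (1 * N) * (1 - z^2 * x^2)"
      unfolding euler_partial_step by (simp add: z_def x_def lessThan_nat_numeral lessThan_nat_1 mult_ac
        del: One_nat_def power_Suc)
    show ?case unfolding 1 2 3 using Suc.IH by algebra
  qed simp
  moreover have "(\<lambda>N. euler_partial 1 (2 * N) ^ 2) \<longlonglongrightarrow> E 1 ^ 2"
    by (intro tendsto_mult_fps tendsto_power_fps tendsto_euler_partial) auto
  ultimately show "(\<lambda>N. triple_partial (-1) 1 1 N * (euler_partial 2 (1 * N))) \<longlonglongrightarrow> E 1 ^ 2"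
    by simp
qed

lemma psi_part_product: "psi_part * (E 1 * E 6) = E 2 * E 3 ^ 2"
proof (rule LIMSEQ_unique)
  show "(\<lambda>N. triple_partial 1 1 2 N * (euler_partial 1 (3 * N) * euler_partial 6 (1 * N))) \<longlonglongrightarrow> psi_part * (E 1 * E 6)"
    unfolding psi_part_def
    by (intro tendsto_mult_fps tendsto_power_fps tendsto_euler_partial jacobi_triple_product) auto
  have "triple_partial 1 1 2 N * (euler_partial 1 (3 * N) * euler_partial 6 (1 * N)) = euler_partial 2 (3 * N) * euler_partial 3 (1 * N) ^ 2" for N
  proof (induction N)
    case (Suc N)
    define z x where "z = (fps_X :: int fps) ^ N" and "x = (fps_X :: int fps)"
    have 1: "triple_partial 1 1 2 (Suc N) = triple_partial 1 1 2 N *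
        ((1 + z^3 * x) * (1 + z^3 * x^2) * (1 - z^3 * x^3))"
      by (simp add: triple_partial_step z_def x_def del: One_nat_def power_Suc)
    have 2: "euler_partial 1 (3 * Suc N) = euler_partial 1 (3 * N) * ((1 - z^3 * x) * (1 - z^3 * x^2) * (1 - z^3 * x^3))"
      unfolding euler_partial_step by (simp add: z_def x_def lessThan_nat_numeral lessThan_nat_1 mult_ac
        del: One_nat_def power_Suc)
    have 3: "euler_partial 2 (3 * Suc N) = euler_partial 2 (3 * N) * ((1 - z^6 * x^2) * (1 - z^6 * x^4) * (1 - z^6 * x^6))"
      unfolding euler_partial_step by (simp add: z_def x_def lessThan_nat_numeral lessThan_nat_1 mult_ac
        del: One_nat_def power_Suc)
    have 4: "euler_partial 3 (1 * Suc N) = euler_partial 3 (1 * N) * (1 - z^3 * x^3)"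
      unfolding euler_partial_step by (simp add: z_def x_def lessThan_nat_numeral lessThan_nat_1 mult_ac
        del: One_nat_def power_Suc)
    have 5: "euler_partial 6 (1 * Suc N) = euler_partial 6 (1 * N) * (1 - z^6 * x^6)"
      unfolding euler_partial_step by (simp add: z_def x_def lessThan_nat_numeral lessThan_nat_1 mult_ac
        del: One_nat_def power_Suc)
    show ?case unfolding 1 2 3 4 5 using Suc.IH by algebra
  qed simp
  moreover have "(\<lambda>N. euler_partial 2 (3 * N) * euler_partial 3 (1 * N) ^ 2) \<longlonglongrightarrow> E 2 * E 3 ^ 2"
    by (intro tendsto_mult_fps tendsto_power_fps tendsto_euler_partial) auto
  ultimately show "(\<lambda>N. triple_partial 1 1 2 N * (euler_partial 1 (3 * N) * euler_partial 6 (1 * N))) \<longlonglongrightarrow> E 2 * E 3 ^ 2"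
    by simp
qed

lemma phi_part_product: "phi_part * (E 2 * E 3) = E 1 * E 6 ^ 2"
proof (rule LIMSEQ_unique)
  show "(\<lambda>N. triple_partial (-1) 1 5 N * (euler_partial 2 (3 * N) * euler_partial 3 (2 * N))) \<longlonglongrightarrow> phi_part * (E 2 * E 3)"
    unfolding phi_part_def
    by (intro tendsto_mult_fps tendsto_power_fps tendsto_euler_partial jacobi_triple_product) auto
  have "triple_partial (-1) 1 5 N * (euler_partial 2 (3 * N) * euler_partial 3 (2 * N)) = euler_partial 1 (6 * N) * euler_partial 6 (1 * N) ^ 2" for N
  proof (induction N)
    case (Suc N)
    define z x where "z = (fps_X :: int fps) ^ N" and "x = (fps_X :: int fps)"
    have 1: "triple_partial (-1) 1 5 (Suc N) = triple_partial (-1) 1 5 N *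
        ((1 - z^6 * x) * (1 - z^6 * x^5) * (1 - z^6 * x^6))"
      by (simp add: triple_partial_step z_def x_def del: One_nat_def power_Suc)
    have 2: "euler_partial 1 (6 * Suc N) = euler_partial 1 (6 * N) * ((1 - z^6 * x) * (1 - z^6 * x^2) * (1 - z^6 * x^3) * (1 - z^6 * x^4) * (1 - z^6 * x^5) * (1 - z^6 * x^6))"
      unfolding euler_partial_step by (simp add: z_def x_def lessThan_nat_numeral lessThan_nat_1 mult_ac
        del: One_nat_def power_Suc)
    have 3: "euler_partial 2 (3 * Suc N) = euler_partial 2 (3 * N) * ((1 - z^6 * x^2) * (1 - z^6 * x^4) * (1 - z^6 * x^6))"
      unfolding euler_partial_step by (simp add: z_def x_def lessThan_nat_numeral lessThan_nat_1 mult_ac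
        del: One_nat_def power_Suc)
    have 4: "euler_partial 3 (2 * Suc N) = euler_partial 3 (2 * N) * ((1 - z^6 * x^3) * (1 - z^6 * x^6))"
      unfolding euler_partial_step by (simp add: z_def x_def lessThan_nat_numeral lessThan_nat_1 mult_ac
        del: One_nat_def power_Suc)
    have 5: "euler_partial 6 (1 * Suc N) = euler_partial 6 (1 * N) * (1 - z^6 * x^6)"
      unfolding euler_partial_step by (simp add: z_def x_def lessThan_nat_numeral lessThan_nat_1 mult_ac
        del: One_nat_def power_Suc)
    show ?case unfolding 1 2 3 4 5 using Suc.IH by algebra
  qed simp
  moreover have "(\<lambda>N. euler_partial 1 (6 * N) * euler_partial 6 (1 * N) ^ 2) \<longlonglongrightarrow> E 1 * E 6 ^ 2"
    by (intro tendsto_mult_fps tendsto_power_fps tendsto_euler_partial) auto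
  ultimately show "(\<lambda>N. triple_partial (-1) 1 5 N * (euler_partial 2 (3 * N) * euler_partial 3 (2 * N))) \<longlonglongrightarrow> E 1 * E 6 ^ 2"
    by simp
qed

section \<open>Dissections modulo 3\<close>

lemma theta_exp_eqI:
  "2 * int r * j + int (r + t) * (j * (j - 1)) = 2 * k \<Longrightarrow> theta_exp r t j = k"
  using two_theta_exp[of r t j] by simp

lemma theta_sign_1: "theta_sign 1 j = 1"
  by (simp add: theta_sign_def)

lemma bij_affine_int: "bij (\<lambda>i::int. c - i)" "bij (\<lambda>i::int. - i)" "bij (\<lambda>i::int. i + c)"
  by (rule bij_betw_byWitness[of _ "\<lambda>i. c - i"] bij_betw_byWitness[of _ "\<lambda>i. - i"]
      bij_betw_byWitness[of _ "\<lambda>i. i - c"]; simp)+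

text \<open>
  The exponent of \<open>psi\<close> is \<open>2 j ^ 2 - j\<close>. The indices \<open>j = 3 i + 1\<close> reproduce \<open>q psi(q^9)\<close>, and \<open>j = 3 i\<close> and
  \<open>j = 3 i + 2\<close> give the even and the odd indices of \<open>psi_part(q^3)\<close>.
\<close>
lemma psi_dissection: "psi = dilate 3 psi_part + fps_X * dilate 9 psi"
proof -
  define w :: "int \<Rightarrow> int" where "w = (\<lambda>_. 1)"
  have w: "theta_sign 1 = w" by (rule ext) (simp add: theta_sign_1 w_def)
  have part: "psi_part = theta w (\<lambda>i. theta_exp 1 2 (2 * i)) + theta w (\<lambda>i. theta_exp 1 2 (2 * i + 1))"
    unfolding psi_part_def w by (subst theta_split[of 2])
      (simp_all add: finite_theta_exp w_def numeral_2_eq_2)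
  have "psi = theta w (\<lambda>i. theta_exp 1 3 (3 * i)) + theta w (\<lambda>i. theta_exp 1 3 (3 * i + 1)) +
      theta w (\<lambda>i. theta_exp 1 3 (3 * i + 2))"
    unfolding psi_def w by (subst theta_split[of 3])
      (simp_all add: finite_theta_exp w_def numeral_3_eq_3)
  also have "theta w (\<lambda>i. theta_exp 1 3 (3 * i)) = dilate 3 (theta w (\<lambda>i. theta_exp 1 2 (2 * i)))"
  proof -
    have "theta_exp 1 3 (3 * i) = int 3 * theta_exp 1 2 (2 * i)" for i
      using two_theta_exp[of 1 2 "2 * i"] by (intro theta_exp_eqI) (simp add: algebra_simps)
    then show ?thesis by (simp only: theta_scale)
  qed
  also have "theta w (\<lambda>i. theta_exp 1 3 (3 * i + 2)) = dilate 3 (theta w (\<lambda>i. theta_exp 1 2 (2 * i + 1)))"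
  proof -
    have "theta_exp 1 3 (3 * i + 2) = int 3 * theta_exp 1 2 (2 * (-1 - i) + 1)" for i
      using two_theta_exp[of 1 2 "2 * (-1 - i) + 1"] by (intro theta_exp_eqI) (simp add: algebra_simps)
    then have "theta w (\<lambda>i. theta_exp 1 3 (3 * i + 2)) = dilate 3 (theta w (\<lambda>i. theta_exp 1 2 (2 * (-1 - i) + 1)))"
      by (simp only: theta_scale)
    also have "theta w (\<lambda>i. theta_exp 1 2 (2 * (-1 - i) + 1)) = theta w (\<lambda>i. theta_exp 1 2 (2 * i + 1))"
      using theta_reindex[OF bij_affine_int(1), of w "-1" "\<lambda>i. theta_exp 1 2 (2 * i + 1)"] by (simp add: w_def)
    finally show ?thesis .
  qed
  also have "theta w (\<lambda>i. theta_exp 1 3 (3 * i + 1)) = fps_X * dilate 9 psi"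
  proof -
    have "theta_exp 1 3 (3 * i + 1) = int 9 * theta_exp 1 3 (- i) + 1" for i
      using two_theta_exp[of 1 3 "- i"] by (intro theta_exp_eqI) (simp add: algebra_simps)
    moreover have "int 9 * theta_exp 1 3 (- i) \<ge> 0" for i
      using theta_exp_ge[of 1 3 "- i"] by simp
    ultimately have "theta w (\<lambda>i. theta_exp 1 3 (3 * i + 1)) = fps_X * dilate 9 (theta w (\<lambda>i. theta_exp 1 3 (- i)))"
      by (simp only: theta_shift theta_scale)
    also have "theta w (\<lambda>i. theta_exp 1 3 (- i)) = psi"
      using theta_reindex[OF bij_affine_int(2), of w "theta_exp 1 3"] by (simp add: w_def psi_def w)
    finally show ?thesis .
  qed
  finally show ?thesis by (simp add: part dilate_add add_ac)
qed

text \<open>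
  The squares divisible by \<open>3\<close> reproduce \<open>phi(q^9)\<close>. The classes \<open>j = 3 i + 1\<close> and \<open>j = 3 i + 2\<close> are exchanged by
  \<open>j \<mapsto> -j\<close> and give equal contributions, hence the factor \<open>2\<close>.
\<close>
lemma phi_dissection: "phi = dilate 9 phi - 2 * fps_X * dilate 3 phi_part"
proof -
  define w where "w = theta_sign (-1)"
  have "phi = theta (\<lambda>i. w (3 * i)) (\<lambda>i. theta_exp 1 1 (3 * i)) +
      theta (\<lambda>i. w (3 * i + 1)) (\<lambda>i. theta_exp 1 1 (3 * i + 1)) +
      theta (\<lambda>i. w (3 * i + 2)) (\<lambda>i. theta_exp 1 1 (3 * i + 2))"
    unfolding phi_def w_def by (subst theta_split[of 3])
      (simp_all add: finite_theta_exp numeral_3_eq_3)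
  also have "theta (\<lambda>i. w (3 * i)) (\<lambda>i. theta_exp 1 1 (3 * i)) = dilate 9 phi"
  proof -
    have "theta_exp 1 1 (3 * i) = int 9 * theta_exp 1 1 i" for i
      using two_theta_exp[of 1 1 i] by (intro theta_exp_eqI) (simp add: algebra_simps)
    moreover have "w (3 * i) = w i" for i by (simp add: w_def theta_sign_def)
    ultimately show ?thesis unfolding phi_def w_def by (simp only: theta_scale)
  qed
  also have "theta (\<lambda>i. w (3 * i + 1)) (\<lambda>i. theta_exp 1 1 (3 * i + 1)) = - (fps_X * dilate 3 phi_part)"
  proof -
    have "theta_exp 1 1 (3 * i + 1) = int 3 * theta_exp 1 5 (- i) + 1" for i
      using two_theta_exp[of 1 5 "- i"] by (intro theta_exp_eqI) (simp add: algebra_simps)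
    moreover have "int 3 * theta_exp 1 5 (- i) \<ge> 0" for i
      using theta_exp_ge[of 1 5 "- i"] by simp
    moreover have "w (3 * i + 1) = - w (- i)" for i by (simp add: w_def theta_sign_def)
    ultimately have "theta (\<lambda>i. w (3 * i + 1)) (\<lambda>i. theta_exp 1 1 (3 * i + 1)) =
        - (fps_X * dilate 3 (theta (\<lambda>i. w (- i)) (\<lambda>i. theta_exp 1 5 (- i))))"
      by (simp only: theta_shift theta_scale theta_uminus)
    also have "theta (\<lambda>i. w (- i)) (\<lambda>i. theta_exp 1 5 (- i)) = phi_part"
      unfolding phi_part_def w_def by (rule theta_reindex[OF bij_affine_int(2)])
    finally show ?thesis .
  qed
  also have "theta (\<lambda>i. w (3 * i + 2)) (\<lambda>i. theta_exp 1 1 (3 * i + 2)) = - (fps_X * dilate 3 phi_part)"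
  proof -
    have "theta_exp 1 1 (3 * i + 2) = int 3 * theta_exp 1 5 (i + 1) + 1" for i
      using two_theta_exp[of 1 5 "i + 1"] by (intro theta_exp_eqI) (simp add: algebra_simps)
    moreover have "int 3 * theta_exp 1 5 (i + 1) \<ge> 0" for i
      using theta_exp_ge[of 1 5 "i + 1"] by simp
    moreover have "w (3 * i + 2) = - w (i + 1)" for i by (simp add: w_def theta_sign_def)
    ultimately have "theta (\<lambda>i. w (3 * i + 2)) (\<lambda>i. theta_exp 1 1 (3 * i + 2)) =
        - (fps_X * dilate 3 (theta (\<lambda>i. w (i + 1)) (\<lambda>i. theta_exp 1 5 (i + 1))))"
      by (simp only: theta_shift theta_scale theta_uminus)
    also have "theta (\<lambda>i. w (i + 1)) (\<lambda>i. theta_exp 1 5 (i + 1)) = phi_part"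
      unfolding phi_part_def w_def by (rule theta_reindex[OF bij_affine_int(3)])
    finally show ?thesis .
  qed
  finally show ?thesis by (simp add: mult.assoc)
qed

section \<open>Exponents of Euler products modulo 5\<close>

text \<open>
  By the pentagonal number theorem the exponents in \<open>E 2\<close> have the form \<open>3 j ^ 2 - j\<close>, which is never
  \<open>1\<close> or \<open>3\<close> modulo \<open>5\<close>.
\<close>
lemma euler_prod_2_nth_eq_0:
  assumes "n mod 5 = 1 \<or> n mod 5 = 3"
  shows "fps_nth (E 2) n = 0"
proof (rule ccontr)
  assume nz: "fps_nth (E 2) n \<noteq> 0"
  have "E 2 = dilate 2 (theta (theta_sign (-1)) (theta_exp 1 2))"
    using dilate_euler_prod[of 2 1] pentagonal by simp
  with nz have n: "2 dvd n" "fps_nth (theta (theta_sign (-1)) (theta_exp 1 2)) (n div 2) \<noteq> 0"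
    by (simp_all add: dilate_nth split: if_splits)
  then obtain j where "theta_exp 1 2 j = int (n div 2)"
    unfolding theta_nth by (metis (mono_tags, lifting) mem_Collect_eq sum.neutral)
  then have "int n = 2 * j + 3 * (j * (j - 1))"
    using n(1) two_theta_exp[of 1 2 j] by auto
  moreover define k c where "k = j div 5" and "c = j mod 5"
  then have "j = 5 * k + c" and c: "c = 0 \<or> c = 1 \<or> c = 2 \<or> c = 3 \<or> c = 4"
    by (simp, presburger)
  ultimately have "int n = 5 * (2 * k + 3 * k * (5 * k + c - 1) + 3 * c * k) + (2 * c + 3 * c * (c - 1))"
    by (simp add: algebra_simps)
  then obtain m where "int n = 5 * m + (2 * c + 3 * c * (c - 1))" by blast
  then have "int n mod 5 = 0 \<or> int n mod 5 = 2 \<or> int n mod 5 = 4"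
    using c by auto
  then show False using assms by presburger
qed

lemma fps_unitE:
  fixes F :: "int fps"
  assumes "fps_nth F 0 = 1"
  obtains G where "G * F = 1"
  using fps_left_inverse[of 1 F] assms by auto

lemma dvd_unit_cancel:
  fixes F :: "int fps"
  assumes "c dvd F * G" "fps_nth F 0 = 1"
  shows "c dvd G"
proof -
  obtain H where "H * F = 1" using fps_unitE assms(2) by blast
  moreover have "c dvd H * (F * G)" using assms(1) by (rule dvd_mult)
  ultimately show ?thesis by (simp flip: mult.assoc)
qed

lemma euler_prod_nth_0: "k > 0 \<Longrightarrow> fps_nth (E k) 0 = 1"
  by (rule has_prod_euler_prod(2))

lemma euler_prod_nonzero: "k > 0 \<Longrightarrow> E k \<noteq> 0"
  using euler_prod_nth_0[of k] by auto

lemma fps_nth_power_0_1: "fps_nth F 0 = 1 \<Longrightarrow> fps_nth (F ^ n) 0 = (1::'a::comm_ring_1)"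
  by (induction n) simp_all

lemma dvd_power_5_diff: "(5 :: int fps) dvd (1 - x) ^ 5 - (1 - x ^ 5)"
proof
  show "(1 - x) ^ 5 - (1 - x ^ 5) = 5 * (2 * x ^ 2 - 2 * x ^ 3 + x ^ 4 - x)" by algebra
qed

lemma numeral_dvd_fps_iff: "(numeral c :: int fps) dvd F \<longleftrightarrow> (\<forall>n. numeral c dvd fps_nth F n)"
proof
  assume "numeral c dvd F"
  then show "\<forall>n. numeral c dvd fps_nth F n"
    by (auto simp: numeral_fps_const)
next
  assume "\<forall>n. numeral c dvd fps_nth F n"
  then have "F = numeral c * Abs_fps (\<lambda>n. fps_nth F n div numeral c)"
    by (intro fps_ext) (simp add: numeral_fps_const)
  then show "numeral c dvd F" by (metis dvd_triv_left)
qed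

text \<open>
  Modulo \<open>5\<close> each factor satisfies \<open>(1 - x) ^ 5 = 1 - x ^ 5\<close>, so a fifth power of an Euler product is
  a series in \<open>q^5\<close>.
\<close>
lemma euler_prod_frobenius:
  assumes "k > 0"
  shows "5 dvd E k ^ 5 - E (5 * k)"
proof -
  have fin: "5 dvd euler_partial k N ^ 5 - euler_partial (5 * k) N" for N
  proof (induction N)
    case (Suc N)
    define x where "x = (fps_X :: int fps) ^ (k * Suc N)"
    have "fps_X ^ (5 * k * Suc N) = x ^ 5"
      by (simp add: x_def algebra_simps flip: power_mult)
    then have "euler_partial k (Suc N) ^ 5 - euler_partial (5 * k) (Suc N) =
        (euler_partial k N ^ 5 - euler_partial (5 * k) N) * (1 - x) ^ 5 +
        euler_partial (5 * k) N * ((1 - x) ^ 5 - (1 - x ^ 5))"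
      by (simp only: euler_partial_Suc x_def [symmetric] power_mult_distrib) (simp add: algebra_simps)
    then show ?case
      using Suc.IH dvd_power_5_diff[of x] by simp
  qed simp
  have "(\<lambda>N. euler_partial k N ^ 5 - euler_partial (5 * k) N) \<longlonglongrightarrow> E k ^ 5 - E (5 * k)"
    using assms by (intro tendsto_diff_fps tendsto_power_fps tendsto_euler_partial') auto
  then have "eventually (\<lambda>N. fps_nth (euler_partial k N ^ 5 - euler_partial (5 * k) N) n =
      fps_nth (E k ^ 5 - E (5 * k)) n) sequentially" for n
    by (simp only: tendsto_fps_iff)
  then show ?thesis
    using fin unfolding numeral_dvd_fps_iff eventually_sequentially by (metis order_refl)
qed

section \<open>The common parameter of both dissections\<close>

lemma psi_quotient: "psi * E 1 = E 2 ^ 2"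
proof -
  have "E 4 * (psi * E 1) = E 4 * E 2 ^ 2"
    using psi_product by (simp add: mult_ac power2_eq_square)
  then show ?thesis using euler_prod_nonzero[of 4] by simp
qed

lemma phi_quotient: "phi * E 2 = E 1 ^ 2"
  using phi_product by simp

lemma dilate_E [simp]: "dilate 3 (E 1) = E 3" "dilate 3 (E 2) = E 6" "dilate 5 (E 1) = E 5" "dilate 5 (E 2) = E 10"
    "dilate 5 (E 3) = E 15"
  by (simp_all add: dilate_euler_prod)

lemma dilate_psi_quotient: "dilate 3 psi * E 3 = E 6 ^ 2"
  using arg_cong[OF psi_quotient, of "dilate 3"] by (simp add: dilate_mult dilate_power del: One_nat_def)

lemma dilate_phi_quotient: "dilate 3 phi * E 6 = E 3 ^ 2"
  using arg_cong[OF phi_quotient, of "dilate 3"] by (simp add: dilate_mult dilate_power del: One_nat_def)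

text \<open>
  Take norms in \<open>psi * E 1 = E 2 ^ 2\<close>; the norms of \<open>E 1\<close> and \<open>E 2\<close> are known.
\<close>
lemma cubic_norm_psi: "cubic_norm psi * (E 1 ^ 4 * E 6 ^ 2) = E 2 ^ 8 * E 3"
proof -
  define a b c where "a = cubic_norm (E 1)" and "b = cubic_norm (E 2)" and "c = cubic_norm psi"
  have "a * E 3 = E 1 ^ 4" "b * E 6 = E 2 ^ 4"
    using cubic_norm_euler_prod[of 1] cubic_norm_euler_prod[of 2] by (simp_all add: a_def b_def)
  moreover have "c * a = b ^ 2"
    using arg_cong[OF psi_quotient, of cubic_norm] by (simp add: cubic_norm_mult a_def b_def c_def power2_eq_square)
  ultimately show ?thesis unfolding c_def [symmetric] by algebra
qed

lemma cubic_norm_phi: "cubic_norm phi * (E 2 ^ 4 * E 3 ^ 2) = E 1 ^ 8 * E 6"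
proof -
  define a b c where "a = cubic_norm (E 1)" and "b = cubic_norm (E 2)" and "c = cubic_norm phi"
  have "a * E 3 = E 1 ^ 4" "b * E 6 = E 2 ^ 4"
    using cubic_norm_euler_prod[of 1] cubic_norm_euler_prod[of 2] by (simp_all add: a_def b_def)
  moreover have "c * b = a ^ 2"
    using arg_cong[OF phi_quotient, of cubic_norm] by (simp add: cubic_norm_mult a_def b_def c_def power2_eq_square)
  ultimately show ?thesis unfolding c_def [symmetric] by algebra
qed

text \<open>
  The heart of the computation: with \<open>x = E 1 * E 6 ^ 3 / (E 2 * E 3 ^ 3)\<close> and \<open>u = q x(q^3)\<close>, both theta
  functions are linear in \<open>u\<close>. That the same \<open>u\<close> serves for both follows from comparing the
  product formulas, and taking norms evaluates \<open>1 + u^3\<close> and \<open>1 - 8 u^3\<close>. The last two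
  conclusions state this in terms of \<open>x\<close>, that is, with \<open>q\<close> in place of \<open>q^3\<close>.
\<close>
lemma parametrization:
  obtains x where "x * psi_part = dilate 3 psi"
    and "psi = dilate 3 psi_part * (1 + fps_X * dilate 3 x)"
    and "phi = dilate 3 (dilate 3 phi) * (1 - 2 * (fps_X * dilate 3 x))"
    and "psi_part ^ 3 * (1 + fps_X * x ^ 3) * (E 1 ^ 4 * E 6 ^ 2) = E 2 ^ 8 * E 3"
    and "dilate 3 phi ^ 3 * (1 - 8 * (fps_X * x ^ 3)) * (E 2 ^ 4 * E 3 ^ 2) = E 1 ^ 8 * E 6"
proof -
  define P G where "P = dilate 3 psi" and "G = dilate 3 phi"
  obtain V where V: "V * (E 2 * E 3 ^ 3) = 1"
    by (rule fps_unitE[of "E 2 * E 3 ^ 3"]) (simp_all add: euler_prod_nth_0 fps_nth_power_0_1)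
  define x where "x = V * (E 1 * E 6 ^ 3)"
  have x: "x * (E 2 * E 3 ^ 3) = E 1 * E 6 ^ 3"
    using V unfolding x_def by algebra
  have P: "P * E 3 = E 6 ^ 2" and G: "G * E 6 = E 3 ^ 2"
    unfolding P_def G_def by (rule dilate_psi_quotient dilate_phi_quotient)+
  have "(E 2 * E 3 ^ 3 * E 1 * E 6) * (x * psi_part) = (E 2 * E 3 ^ 3 * E 1 * E 6) * P"
    using x P psi_part_product by algebra
  then have 1: "x * psi_part = P"
    using euler_prod_nonzero[of 1] euler_prod_nonzero[of 2] euler_prod_nonzero[of 3] euler_prod_nonzero[of 6] by simp
  have "(E 2 ^ 2 * E 3 ^ 4 * E 6) * (x * G) = (E 2 ^ 2 * E 3 ^ 4 * E 6) * phi_part"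
    using x G phi_part_product by algebra
  then have 2: "x * G = phi_part"
    using euler_prod_nonzero[of 2] euler_prod_nonzero[of 3] euler_prod_nonzero[of 6] by simp
  have "dilate 9 psi = dilate 3 x * dilate 3 psi_part"
    using arg_cong[OF 1, of "dilate 3"] by (simp add: P_def dilate_dilate dilate_mult)
  then have psi: "psi = dilate 3 psi_part * (1 + fps_X * dilate 3 x)"
    using psi_dissection by algebra
  have "dilate 3 phi_part = dilate 3 x * dilate 9 phi"
    using arg_cong[OF 2, of "dilate 3"] by (simp add: G_def dilate_dilate dilate_mult)
  then have "phi = dilate 9 phi * (1 - 2 * (fps_X * dilate 3 x))"
    using phi_dissection by algebra
  then have phi: "phi = dilate 3 G * (1 - 2 * (fps_X * dilate 3 x))"
    by (simp add: G_def dilate_dilate)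
  have "psi = dilate 3 psi_part + fps_X * dilate 3 (psi_part * x) + fps_X ^ 2 * dilate 3 0"
    using psi by (simp add: dilate_mult algebra_simps)
  then have "cubic_norm psi = psi_part ^ 3 + fps_X * (psi_part * x) ^ 3"
    using cubic_norm_decomposed[of psi_part "psi_part * x" 0] by simp
  then have N1: "cubic_norm psi = psi_part ^ 3 * (1 + fps_X * x ^ 3)" by algebra
  have "phi = dilate 3 G + fps_X * dilate 3 (- (2 * (G * x))) + fps_X ^ 2 * dilate 3 0"
    using phi by (simp add: dilate_mult dilate_uminus algebra_simps)
  then have "cubic_norm phi = G ^ 3 + fps_X * (- (2 * (G * x))) ^ 3"
    using cubic_norm_decomposed[of G "- (2 * (G * x))" 0] by simp
  then have N2: "cubic_norm phi = G ^ 3 * (1 - 8 * (fps_X * x ^ 3))" by algebra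
  show thesis
    using that[OF 1 [unfolded P_def] psi phi [unfolded G_def] cubic_norm_psi [unfolded N1]
        cubic_norm_phi [unfolded N2 G_def]] .
qed

section \<open>Two trisections of the generating function\<close>

text \<open>
  The generating function of \<open>d(3n + 2)\<close>. Multiplying \<open>D * psi * phi = E 3 ^ 3\<close> by the conjugates of
  \<open>1 + u\<close> and \<open>1 - 2 u\<close> leaves a series in \<open>q^3\<close> in front of \<open>D\<close>, so the class of \<open>2\<close> modulo \<open>3\<close> can be read
  off; on the right it comes from the single term \<open>3 u^2\<close>.
\<close>
lemma trisection_d: "dissect 3 2 (Abs_fps d) * (E 1 * E 2 ^ 4) = 3 * E 3 ^ 3 * E 6 ^ 3"
proof -
  obtain x where xA: "x * psi_part = dilate 3 psi"
    and psi: "psi = dilate 3 psi_part * (1 + fps_X * dilate 3 x)"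
    and phi: "phi = dilate 3 (dilate 3 phi) * (1 - 2 * (fps_X * dilate 3 x))"
    and NN: "psi_part ^ 3 * (1 + fps_X * x ^ 3) * (E 1 ^ 4 * E 6 ^ 2) = E 2 ^ 8 * E 3"
      "dilate 3 phi ^ 3 * (1 - 8 * (fps_X * x ^ 3)) * (E 2 ^ 4 * E 3 ^ 2) = E 1 ^ 8 * E 6"
    by (rule parametrization)
  define A where "A = psi_part"
  define G where "G = dilate 3 phi"
  define u where "u = fps_X * dilate 3 x"
  define y where "y = fps_X * x ^ 3"
  define D where "D = Abs_fps d"
  define D' where "D' = dissect 3 2 D"
  note psi = psi [folded A_def u_def] and phi = phi [folded G_def, folded u_def]
    and NN = NN [folded y_def A_def G_def] and xA = xA [folded A_def]
  have u3: "u ^ 3 = dilate 3 y"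
    by (simp add: u_def y_def dilate_mult dilate_power dilate_X power_mult_distrib)
  have pp: "psi * phi = E 1 * E 2"
  proof -
    have "(E 1 * E 2) * (psi * phi) = (E 1 * E 2) * (E 1 * E 2)"
      using psi_quotient phi_quotient by algebra
    then show ?thesis using euler_prod_nonzero[of 1] euler_prod_nonzero[of 2] by simp
  qed
  have D: "D * (psi * phi) = E 3 ^ 3"
    using d_generating_function by (simp only: D_def pp)
  have "dilate 3 (A * G * ((1 + y) * (1 - 8 * y))) * D = D * (psi * phi) * ((1 - u + u^2) * (1 + 2 * u + 4 * u^2))"
    unfolding phi psi dilate_mult[OF zero_less_numeral] dilate_add dilate_diff dilate_1 dilate_numeral u3 [symmetric]
    by algebra
  also have "\<dots> = dilate 3 (E 1 ^ 3) * (1 + u + 3 * u^2 - 2 * u^3 + 4 * u^3 * u)"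
    unfolding D dilate_power[OF zero_less_numeral] dilate_E(1) by algebra
  also have "1 + u + 3 * u^2 - 2 * u^3 + 4 * u^3 * u =
      dilate 3 (1 - 2 * y) + fps_X * dilate 3 (x * (1 + 4 * y)) + fps_X ^ 2 * dilate 3 (3 * x ^ 2)"
    unfolding u3 by (simp add: u_def dilate_add dilate_mult dilate_diff dilate_power algebra_simps power2_eq_square)
  finally have "dissect 3 2 (dilate 3 (A * G * ((1 + y) * (1 - 8 * y))) * D) =
    dissect 3 2 (dilate 3 (E 1 ^ 3) * (dilate 3 (1 - 2 * y) + fps_X * dilate 3 (x * (1 + 4 * y)) + fps_X ^ 2 * dilate 3 (3 * x ^ 2)))"
    by (rule arg_cong)
  then have key: "A * G * ((1 + y) * (1 - 8 * y)) * D' = E 1 ^ 3 * (3 * x ^ 2)"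
    by (simp add: dissect_dilate_mult dissect_decomposed D'_def)
  \<comment> \<open>the factor \<open>A ^ 2 * G ^ 2\<close> completes \<open>A * G\<close> to the cubes that occur in the norms\<close>
  have "D' * (E 2 ^ 8 * E 3) * (E 1 ^ 8 * E 6) =
      (A * G * ((1 + y) * (1 - 8 * y)) * D') * (A ^ 2 * G ^ 2) * (E 1 ^ 4 * E 6 ^ 2) * (E 2 ^ 4 * E 3 ^ 2)"
    unfolding NN [symmetric] by algebra
  also have "\<dots> = 3 * E 1 ^ 7 * E 2 ^ 4 * ((x * A) * E 3) ^ 2 * (G * E 6) ^ 2"
    unfolding key by algebra
  also have "\<dots> = 3 * E 1 ^ 7 * E 2 ^ 4 * (E 6 ^ 2) ^ 2 * (E 3 ^ 2) ^ 2"
    using xA dilate_psi_quotient dilate_phi_quotient unfolding A_def G_def by (simp only:)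
  finally have "(E 1 ^ 7 * E 2 ^ 4 * E 3 * E 6) * (D' * (E 1 * E 2 ^ 4)) =
      (E 1 ^ 7 * E 2 ^ 4 * E 3 * E 6) * (3 * E 3 ^ 3 * E 6 ^ 3)"
    by algebra
  then show ?thesis
    using euler_prod_nonzero[of 1] euler_prod_nonzero[of 2] euler_prod_nonzero[of 3] euler_prod_nonzero[of 6] by (simp add: D'_def D_def)
qed

text \<open>
  The same procedure for \<open>D' * psi ^ 3 * phi ^ 2 = 3 * E 3 ^ 3 * E 6 ^ 3\<close>. Now three powers of \<open>u\<close> fall into the class
  of \<open>2\<close> modulo \<open>3\<close>, but two of them have coefficients divisible by \<open>5\<close>.
\<close>
lemma ninesection_d_mod_5:
  "5 dvd dissect 3 2 (dissect 3 2 (Abs_fps d)) * (E 1 ^ 5 * E 2 ^ 9) - 3 * E 3 ^ 15"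
proof -
  obtain x where xA: "x * psi_part = dilate 3 psi"
    and psi: "psi = dilate 3 psi_part * (1 + fps_X * dilate 3 x)"
    and phi: "phi = dilate 3 (dilate 3 phi) * (1 - 2 * (fps_X * dilate 3 x))"
    and NN: "psi_part ^ 3 * (1 + fps_X * x ^ 3) * (E 1 ^ 4 * E 6 ^ 2) = E 2 ^ 8 * E 3"
      "dilate 3 phi ^ 3 * (1 - 8 * (fps_X * x ^ 3)) * (E 2 ^ 4 * E 3 ^ 2) = E 1 ^ 8 * E 6"
    by (rule parametrization)
  define A where "A = psi_part"
  define G where "G = dilate 3 phi"
  define u where "u = fps_X * dilate 3 x"
  define y where "y = fps_X * x ^ 3"
  define D' where "D' = dissect 3 2 (Abs_fps d)"
  define D'' where "D'' = dissect 3 2 D'"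
  note psi = psi [folded A_def u_def] and phi = phi [folded G_def, folded u_def]
    and NN = NN [folded y_def A_def G_def] and xA = xA [folded A_def]
  have u3: "u ^ 3 = dilate 3 y"
    by (simp add: u_def y_def dilate_mult dilate_power dilate_X power_mult_distrib)
  have pp: "psi ^ 3 * phi ^ 2 = E 1 * E 2 ^ 4"
  proof -
    have "(E 1 ^ 3 * E 2 ^ 2) * (psi ^ 3 * phi ^ 2) = (E 1 ^ 3 * E 2 ^ 2) * (E 1 * E 2 ^ 4)"
      using psi_quotient phi_quotient by algebra
    then show ?thesis using euler_prod_nonzero[of 1] euler_prod_nonzero[of 2] by simp
  qed
  have D: "D' * (psi ^ 3 * phi ^ 2) = 3 * E 3 ^ 3 * E 6 ^ 3"
    using trisection_d by (simp only: D'_def pp)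
  define K where "K = A ^ 3 * G ^ 2 * ((1 + y) ^ 3 * (1 - 8 * y) ^ 2)"
  define c0 c1 where "c0 = 1 - 3 * y + 45 * y ^ 2 - 32 * y ^ 3"
    and "c1 = x * (1 + 18 * y - 48 * y ^ 2 + 16 * y ^ 3)"
  define c2 where "c2 = x ^ 2 * (6 - 15 * y + 60 * y ^ 2)"
  have "dilate 3 K = dilate 3 A ^ 3 * dilate 3 G ^ 2 * ((1 + u ^ 3) ^ 3 * (1 - 8 * u ^ 3) ^ 2)"
    unfolding K_def u3 by (simp add: dilate_mult dilate_add dilate_diff dilate_power)
  also have "1 + u ^ 3 = (1 + u) * (1 - u + u ^ 2)" by algebra
  also have "1 - 8 * u ^ 3 = (1 - 2 * u) * (1 + 2 * u + 4 * u ^ 2)" by algebra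
  finally have "dilate 3 K * D' = D' * (psi ^ 3 * phi ^ 2) * ((1 - u + u ^ 2) ^ 3 * (1 + 2 * u + 4 * u ^ 2) ^ 2)"
    unfolding phi psi by (simp only: power_mult_distrib mult_ac)
  \<comment> \<open>collect the powers of \<open>u\<close> by their exponents modulo \<open>3\<close>, as \<open>u ^ 3\<close> is a series in \<open>q^3\<close>\<close>
  also have "(1 - u + u ^ 2) ^ 3 * (1 + 2 * u + 4 * u ^ 2) ^ 2 =
      (1 - 3 * u ^ 3 + 45 * (u ^ 3) ^ 2 - 32 * (u ^ 3) ^ 3) +
      u * (1 + 18 * u ^ 3 - 48 * (u ^ 3) ^ 2 + 16 * (u ^ 3) ^ 3) +
      u ^ 2 * (6 - 15 * u ^ 3 + 60 * (u ^ 3) ^ 2)"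
    by algebra
  also have "\<dots> = dilate 3 c0 + fps_X * dilate 3 c1 + fps_X ^ 2 * dilate 3 c2"
    unfolding u3 unfolding u_def c0_def c1_def c2_def
    by (simp add: dilate_mult dilate_add dilate_diff dilate_power power_mult_distrib mult.assoc)
  also have "D' * (psi ^ 3 * phi ^ 2) = dilate 3 (3 * E 1 ^ 3 * E 2 ^ 3)"
    unfolding D dilate_mult[OF zero_less_numeral] dilate_power[OF zero_less_numeral] dilate_E dilate_numeral ..
  finally have "dissect 3 2 (dilate 3 K * D') =
    dissect 3 2 (dilate 3 (3 * E 1 ^ 3 * E 2 ^ 3) * (dilate 3 c0 + fps_X * dilate 3 c1 + fps_X ^ 2 * dilate 3 c2))"
    by (rule arg_cong)
  then have key: "K * D'' = 3 * E 1 ^ 3 * E 2 ^ 3 * c2"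
    by (simp add: dissect_dilate_mult dissect_decomposed D''_def)
  \<comment> \<open>the factor \<open>E 6 ^ 2\<close> completes the powers of \<open>E 6\<close> that turn \<open>A ^ 4\<close>, \<open>G ^ 4\<close> into Euler products\<close>
  have "D'' * (E 2 ^ 8 * E 3) ^ 3 * (E 1 ^ 8 * E 6) ^ 2 * E 6 ^ 2 =
      (K * D'') * (A ^ 6 * G ^ 4) * (E 1 ^ 4 * E 6 ^ 2) ^ 3 * (E 2 ^ 4 * E 3 ^ 2) ^ 2 * E 6 ^ 2"
    unfolding NN [symmetric] K_def by algebra
  also have "\<dots> = 3 * E 1 ^ 11 * E 2 ^ 11 * E 3 ^ 2 * (6 - 15 * y + 60 * y ^ 2) *
      (A * (E 1 * E 6)) ^ 4 * ((x * A) * E 3) ^ 2 * (G * E 6) ^ 4"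
    unfolding key c2_def by algebra
  also have "\<dots> = 3 * E 1 ^ 11 * E 2 ^ 11 * E 3 ^ 2 * (6 - 15 * y + 60 * y ^ 2) *
      (E 2 * E 3 ^ 2) ^ 4 * (E 6 ^ 2) ^ 2 * (E 3 ^ 2) ^ 4"
    using xA dilate_psi_quotient dilate_phi_quotient psi_part_product unfolding A_def G_def by (simp only:)
  finally have "(E 1 ^ 11 * E 2 ^ 15 * E 3 ^ 3 * E 6 ^ 4) * (D'' * (E 1 ^ 5 * E 2 ^ 9)) =
      (E 1 ^ 11 * E 2 ^ 15 * E 3 ^ 3 * E 6 ^ 4) * (3 * E 3 ^ 15 * (6 - 15 * y + 60 * y ^ 2))"
    by algebra
  then have "D'' * (E 1 ^ 5 * E 2 ^ 9) = 3 * E 3 ^ 15 * (6 - 15 * y + 60 * y ^ 2)"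
    using euler_prod_nonzero[of 1] euler_prod_nonzero[of 2] euler_prod_nonzero[of 3] euler_prod_nonzero[of 6] by simp
  then have "D'' * (E 1 ^ 5 * E 2 ^ 9) - 3 * E 3 ^ 15 = 5 * (3 * E 3 ^ 15 * (1 - 3 * y + 12 * y ^ 2))"
    by algebra
  then show ?thesis unfolding D''_def D'_def by (metis dvd_triv_left)
qed

section \<open>The congruences\<close>

lemma dvd_dissect: "(numeral c :: int fps) dvd F \<Longrightarrow> numeral c dvd dissect m r F"
  by (simp add: numeral_dvd_fps_iff)

lemma dvd_diff_mult:
  "(m :: 'a::comm_ring_1) dvd a - b \<Longrightarrow> m dvd c - e \<Longrightarrow> m dvd a * c - b * e"
proof -
  assume "m dvd a - b" "m dvd c - e"
  then have "m dvd (a - b) * c + b * (c - e)" by simp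
  then show ?thesis by (simp add: algebra_simps)
qed

theorem theorem5p4:
  fixes n t :: nat
  assumes "t \<in> {17, 35}"
  shows "[d (45 * n + t) = 0] (mod 5)"
proof -
  define D'' where "D'' = dissect 3 2 (dissect 3 2 (Abs_fps d))"
  define r :: nat where "r = (if t = 17 then 1 else 3)"
  have r: "r < 5" "r = 1 \<or> r = 3" and t: "45 * n + t = 9 * (5 * n + r) + 8"
    using assms by (auto simp: r_def)
  have F: "5 dvd E 1 ^ 5 - dilate 5 (E 1)" "5 dvd E 2 ^ 5 - dilate 5 (E 2)" "5 dvd E 3 ^ 5 - dilate 5 (E 3)"
    using euler_prod_frobenius[of 1] euler_prod_frobenius[of 2] euler_prod_frobenius[of 3]
    by (simp_all del: One_nat_def)
  \<comment> \<open>the factor \<open>E 2\<close> completes \<open>E 2 ^ 9\<close> to a square of a fifth power\<close>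
  have "5 dvd E 2 * (D'' * (E 1 ^ 5 * E 2 ^ 9) - 3 * E 3 ^ 15)"
    unfolding D''_def by (intro dvd_mult ninesection_d_mod_5)
  moreover have "5 dvd D'' * (E 1 ^ 5 * (E 2 ^ 5 * E 2 ^ 5) - dilate 5 (E 1) * (dilate 5 (E 2) * dilate 5 (E 2)))"
    by (intro dvd_mult dvd_diff_mult F)
  moreover have "5 dvd 3 * E 2 * (E 3 ^ 5 * (E 3 ^ 5 * E 3 ^ 5) - dilate 5 (E 3) * (dilate 5 (E 3) * dilate 5 (E 3)))"
    by (intro dvd_mult dvd_diff_mult F)
  ultimately have "5 dvd E 2 * (D'' * (E 1 ^ 5 * E 2 ^ 9) - 3 * E 3 ^ 15)
      - D'' * (E 1 ^ 5 * (E 2 ^ 5 * E 2 ^ 5) - dilate 5 (E 1) * (dilate 5 (E 2) * dilate 5 (E 2)))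
      + 3 * E 2 * (E 3 ^ 5 * (E 3 ^ 5 * E 3 ^ 5) - dilate 5 (E 3) * (dilate 5 (E 3) * dilate 5 (E 3)))"
    by (intro dvd_add dvd_diff)
  also have "\<dots> = dilate 5 (E 1 * (E 2 * E 2)) * D'' - dilate 5 (3 * E 3 * (E 3 * E 3)) * E 2"
    unfolding dilate_mult[OF zero_less_numeral] dilate_numeral by algebra
  finally have "5 dvd dissect 5 r \<dots>"
    by (rule dvd_dissect)
  moreover have "dissect 5 r (E 2) = 0"
    using r by (intro fps_ext) (auto intro!: euler_prod_2_nth_eq_0 simp: r_def)
  ultimately have "5 dvd E 1 * (E 2 * E 2) * dissect 5 r D''"
    using r by (simp add: dissect_diff dissect_dilate_mult)
  then have "5 dvd dissect 5 r D''"
    by (rule dvd_unit_cancel) (simp add: euler_prod_nth_0)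
  then have "5 dvd fps_nth (dissect 5 r D'') n"
    by (simp add: numeral_dvd_fps_iff)
  also have "fps_nth (dissect 5 r D'') n = d (45 * n + t)"
    unfolding t by (simp add: D''_def algebra_simps)
  finally show ?thesis by (simp add: cong_0_iff)
qed

end
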